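(* Assume that $U$ has the Whitney property. Then, for every initial value $\bar x\in\mathbb{R}^n$ and every control pair $(u,v)\in BV([a,b];U)\times L^1([a,b];V)$, there exists a BV simple limit solution, corresponding to $\bar x$ and $(u,v)$, of the Cauchy problem $$\dot x=f(t,x,u,v)+\sum_{\alpha=1}^m g_\alpha(x)\,\dot u_\alpha,\quad t\in[a,b],\qquad x(a)=\bar x.$$
   Context: Notation. $[a,b]$ is a compact interval. For $E\subset\mathbb{R}^d$: $\mathcal{L}^1([a,b];E)$ is the set of pointwise (everywhere) defined Lebesgue integrable functions from $[a,b]$ with values in $E$, while $L^1([a,b];E)$ is the corresponding set of equivalence classes modulo equality a.e.; $AC([a,b];E)$ is the set of absolutely continuous maps, and $BV([a,b];E)$ the set of (everywhere defined) maps of bounded total variation, from $[a,b]$ to $E$. $\mathrm{Var}_I(h)$ is the total variation of $h$ on $I$. $\|\cdot\|_1$ is the $L^1$-norm. Standing hypotheses. Here $f:[a,b]\times\mathbb{R}^n\times\mathbb{R}^m\times V\to\mathbb{R}^n$ and $g_1,\dots,g_m:\mathbb{R}^n\to\mathbb{R}^n$. (i) $U\subset\mathbb{R}^m$ is compact and such that for every bounded interval $I\subset\mathbb{R}$, each $\tau\in I$ and every $w\in\mathcal{L}^1(I;U)$ there is a sequence $(w_k^\tau)\subset AC(I;U)$ with $|w_k^\tau(\tau)-w(\tau)|+\|w_k^\tau-w\|_1\to0$. (ii) $V\subset\mathbb{R}^l$ is compact. (iii) For each $(x,u,v)$ the map $t\mapsto f(t,x,u,v)$ is measurable on $[a,b]$;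 for each $t\in[a,b]$ the map $(x,u,v)\mapsto f(t,x,u,v)$ is continuous on $\mathbb{R}^n\times\mathbb{R}^m\times V$; and $(x,u)\mapsto f(t,x,u,v)$ is locally Lipschitz on $\mathbb{R}^n\times\mathbb{R}^m$, uniformly in $(t,v)\in[a,b]\times V$. (iv) Each $g_\alpha$ is of class $C^1$. (v) There is $M>0$ with $|(f(t,x,u,v),g_1(x),\dots,g_m(x))|\le M(1+|(x,u)|)$ for every $(x,u)\in\mathbb{R}^n\times\mathbb{R}^m$, uniformly in $(t,v)\in[a,b]\times V$. Under (ii)–(v), for $\bar x\in\mathbb{R}^n$ and $(u,v)\in AC([a,b];U)\times L^1([a,b];V)$ the Cauchy problem has a unique Carathéodory solution on $[a,b]$. Whitney property. A compact set $U\subset\mathbb{R}^m$ has the Whitney property if there is $M\ge1$ such that for every $(u_1,u_2)\in U\times U$ there is an absolutely continuous path $\gamma:[0,1]\to U$ with $\gamma(0)=u_1$, $\gamma(1)=u_2$ and $\mathrm{Var}_{[0,1]}(\gamma)\le M|u_1-u_2|$. Limit solutions. Let $\bar x\in\mathbb{R}^n$, $u\in\mathcal{L}^1([a,b];U)$, $v\in L^1([a,b];V)$. A map $x:[a,b]\to\mathbb{R}^n$ is a limit solution of the Cauchy problem corresponding to $\bar x$ and $(u,v)$ if for every $\tau\in[a,b]$ there is a sequence $(u_k^\tau)$ of absolutely continuous maps from $[a,b]$ into $U$ such that: for each $k$ there exists a Carathéodory solution $x_k^\tau:[a,b]\to\mathbb{R}^n$ of the Cauchy problem with initial value $\bar x$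 and control $(u_k^\tau,v)$, the sequence $(x_k^\tau)$ is bounded, and $$|(x_k^\tau,u_k^\tau)(\tau)-(x,u)(\tau)|+\|(x_k^\tau,u_k^\tau)-(x,u)\|_1\to0 .$$ A limit solution is simple if $(u_k^\tau)$ can be chosen independently of $\tau$ (the sequence is then written $(u_k)$). A simple limit solution is a BV simple limit solution if the approximating inputs $u_k$ (chosen independently of $\tau$) have equibounded variation on $[a,b]$. *)

theory Defs
  imports "HOL-Analysis.Analysis"
begin

definition absolutely_continuous_on :: "real set \<Rightarrow> (real \<Rightarrow> 'a::real_normed_vector) \<Rightarrow> bool" where
  "absolutely_continuous_on I h \<longleftrightarrow>
     (\<forall>\<epsilon>>0. \<exists>\<delta>>0. \<forall>(N::nat) c d.
        (\<forall>i<N. c i \<le> d i \<and> {c i..d i} \<subseteq> I) \<and>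
        disjoint_family_on (\<lambda>i. {c i<..<d i}) {..<N} \<and>
        (\<Sum>i<N. d i - c i) < \<delta>
        \<longrightarrow> (\<Sum>i<N. norm (h (d i) - h (c i))) < \<epsilon>)"

definition total_variation :: "real set \<Rightarrow> (real \<Rightarrow> 'a::real_normed_vector) \<Rightarrow> ennreal" where
  "total_variation I h =
     Sup {(\<Sum>i<N. ennreal (norm (h (t (Suc i)) - h (t i)))) | (N::nat) t.
            mono_on {..N} t \<and> t ` {..N} \<subseteq> I}"

definition AC :: "real set \<Rightarrow> 'a::real_normed_vector set \<Rightarrow> (real \<Rightarrow> 'a) set" where
  "AC I E = {h. h ` I \<subseteq> E \<and> absolutely_continuous_on I h}"

definition BV :: "real set \<Rightarrow> 'a::real_normed_vector set \<Rightarrow> (real \<Rightarrow> 'a) set" where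
  "BV I E = {h. h ` I \<subseteq> E \<and> total_variation I h < \<infinity>}"

definition L1_maps :: "real set \<Rightarrow> 'a::euclidean_space set \<Rightarrow> (real \<Rightarrow> 'a) set" where
  "L1_maps I E = {h. h ` I \<subseteq> E \<and> h absolutely_integrable_on I}"

text \<open>Representatives of the classes (modulo equality a.e.) in \<open>L\<^sup>1(I;E)\<close>: the
  values need to lie in \<open>E\<close> only almost everywhere.\<close>

definition L1_reps :: "real set \<Rightarrow> 'a::euclidean_space set \<Rightarrow> (real \<Rightarrow> 'a) set" where
  "L1_reps I E = {h. (AE t in lebesgue_on I. h t \<in> E) \<and> h absolutely_integrable_on I}"

definition L1_norm :: "real set \<Rightarrow> (real \<Rightarrow> 'a::euclidean_space) \<Rightarrow> real" where
  "L1_norm I h = set_lebesgue_integral lebesgue I (\<lambda>t. norm (h t))"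

definition AC_approximable :: "'a::euclidean_space set \<Rightarrow> bool" where
  "AC_approximable U \<longleftrightarrow>
     (\<forall>I. is_interval I \<and> bounded I \<longrightarrow>
       (\<forall>\<tau>\<in>I. \<forall>w\<in>L1_maps I U. \<exists>wk :: nat \<Rightarrow> real \<Rightarrow> 'a.
          (\<forall>k. wk k \<in> AC I U) \<and>
          (\<lambda>k. norm (wk k \<tau> - w \<tau>) + L1_norm I (\<lambda>t. wk k t - w t)) \<longlonglongrightarrow> 0))"

definition whitney_property :: "'a::euclidean_space set \<Rightarrow> bool" where
  "whitney_property U \<longleftrightarrow>
     (\<exists>M\<ge>1. \<forall>u1\<in>U. \<forall>u2\<in>U. \<exists>\<gamma>\<in>AC {0..1} U.
        \<gamma> 0 = u1 \<and> \<gamma> 1 = u2 \<and> total_variation {0..1} \<gamma> \<le> ennreal (M * norm (u1 - u2)))"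

definition C1_map :: "('a::real_normed_vector \<Rightarrow> 'b::real_normed_vector) \<Rightarrow> bool" where
  "C1_map h \<longleftrightarrow>
     (\<exists>D :: 'a \<Rightarrow> 'a \<Rightarrow>\<^sub>L 'b. (\<forall>x. (h has_derivative blinfun_apply (D x)) (at x)) \<and> continuous_on UNIV D)"

definition caratheodory_solution ::
  "real \<Rightarrow> real \<Rightarrow> (real \<Rightarrow> real^'n \<Rightarrow> real^'m \<Rightarrow> real^'l \<Rightarrow> real^'n) \<Rightarrow> ('m \<Rightarrow> real^'n \<Rightarrow> real^'n)
   \<Rightarrow> real^'n \<Rightarrow> (real \<Rightarrow> real^'m) \<Rightarrow> (real \<Rightarrow> real^'l) \<Rightarrow> (real \<Rightarrow> real^'n) \<Rightarrow> bool" where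
  "caratheodory_solution a b f g xbar u v x \<longleftrightarrow>
     absolutely_continuous_on {a..b} x \<and> x a = xbar \<and>
     (AE t in lebesgue_on {a..b}. \<exists>du.
        (u has_vector_derivative du) (at t within {a..b}) \<and>
        (x has_vector_derivative
           f t (x t) (u t) (v t) + (\<Sum>\<alpha>\<in>UNIV. du $ \<alpha> *\<^sub>R g \<alpha> (x t))) (at t within {a..b}))"

definition approximating_inputs ::
  "real \<Rightarrow> real \<Rightarrow> (real^'m) set
   \<Rightarrow> (real \<Rightarrow> real^'n \<Rightarrow> real^'m \<Rightarrow> real^'l \<Rightarrow> real^'n) \<Rightarrow> ('m \<Rightarrow> real^'n \<Rightarrow> real^'n)
   \<Rightarrow> real^'n \<Rightarrow> (real \<Rightarrow> real^'m) \<Rightarrow> (real \<Rightarrow> real^'l) \<Rightarrow> (real \<Rightarrow> real^'n)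
   \<Rightarrow> real \<Rightarrow> (nat \<Rightarrow> real \<Rightarrow> real^'m) \<Rightarrow> bool" where
  "approximating_inputs a b U f g xbar u v x \<tau> uk \<longleftrightarrow>
     (\<forall>k. uk k \<in> AC {a..b} U) \<and>
     (\<exists>xk :: nat \<Rightarrow> real \<Rightarrow> real^'n.
        (\<forall>k. caratheodory_solution a b f g xbar (uk k) v (xk k)) \<and>
        (\<exists>B. \<forall>k. \<forall>t\<in>{a..b}. norm (xk k t) \<le> B) \<and>
        (\<lambda>k. norm ((xk k \<tau>, uk k \<tau>) - (x \<tau>, u \<tau>)) +
             L1_norm {a..b} (\<lambda>t. (xk k t, uk k t) - (x t, u t))) \<longlonglongrightarrow> 0)"

text \<open>Integrability of \<open>x\<close> and \<open>u\<close> is required explicitly because the Bochner integral of a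
  non-integrable function is \<open>0\<close>, which would make the \<open>L\<^sup>1\<close>-convergence in
  \<open>approximating_inputs\<close> vacuous.\<close>

definition limit_solution ::
  "real \<Rightarrow> real \<Rightarrow> (real^'m) set
   \<Rightarrow> (real \<Rightarrow> real^'n \<Rightarrow> real^'m \<Rightarrow> real^'l \<Rightarrow> real^'n) \<Rightarrow> ('m \<Rightarrow> real^'n \<Rightarrow> real^'n)
   \<Rightarrow> real^'n \<Rightarrow> (real \<Rightarrow> real^'m) \<Rightarrow> (real \<Rightarrow> real^'l) \<Rightarrow> (real \<Rightarrow> real^'n) \<Rightarrow> bool" where
  "limit_solution a b U f g xbar u v x \<longleftrightarrow>
     u \<in> L1_maps {a..b} U \<and> x \<in> L1_maps {a..b} UNIV \<and>
     (\<forall>\<tau>\<in>{a..b}. \<exists>uk. approximating_inputs a b U f g xbar u v x \<tau> uk)"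

definition simple_limit_solution ::
  "real \<Rightarrow> real \<Rightarrow> (real^'m) set
   \<Rightarrow> (real \<Rightarrow> real^'n \<Rightarrow> real^'m \<Rightarrow> real^'l \<Rightarrow> real^'n) \<Rightarrow> ('m \<Rightarrow> real^'n \<Rightarrow> real^'n)
   \<Rightarrow> real^'n \<Rightarrow> (real \<Rightarrow> real^'m) \<Rightarrow> (real \<Rightarrow> real^'l) \<Rightarrow> (real \<Rightarrow> real^'n) \<Rightarrow> bool" where
  "simple_limit_solution a b U f g xbar u v x \<longleftrightarrow>
     limit_solution a b U f g xbar u v x \<and>
     (\<exists>uk. \<forall>\<tau>\<in>{a..b}. approximating_inputs a b U f g xbar u v x \<tau> uk)"

definition BV_simple_limit_solution ::
  "real \<Rightarrow> real \<Rightarrow> (real^'m) set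
   \<Rightarrow> (real \<Rightarrow> real^'n \<Rightarrow> real^'m \<Rightarrow> real^'l \<Rightarrow> real^'n) \<Rightarrow> ('m \<Rightarrow> real^'n \<Rightarrow> real^'n)
   \<Rightarrow> real^'n \<Rightarrow> (real \<Rightarrow> real^'m) \<Rightarrow> (real \<Rightarrow> real^'l) \<Rightarrow> (real \<Rightarrow> real^'n) \<Rightarrow> bool" where
  "BV_simple_limit_solution a b U f g xbar u v x \<longleftrightarrow>
     simple_limit_solution a b U f g xbar u v x \<and>
     (\<exists>uk. (\<forall>\<tau>\<in>{a..b}. approximating_inputs a b U f g xbar u v x \<tau> uk) \<and>
           (\<exists>C::real. \<forall>k. total_variation {a..b} (uk k) \<le> ennreal C))"

end

theory Submission
  imports Defs "HOL-Complex_Analysis.Great_Picard"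
begin

text \<open>Join the values of the input at finitely many points by Whitney paths, parametrized
  proportionally to arc length. This gives Lipschitz inputs with values in \<open>U\<close> and variation at
  most a multiple of that of \<open>u\<close>; if the points become dense and exhaust the discontinuities of the
  variation function of \<open>u\<close>, the approximants converge to \<open>u\<close> everywhere. A Gronwall argument
  bounds the corresponding solutions and their variations in terms of the variations of the inputs
  alone, so a Helly selection yields a subsequence of solutions converging everywhere, and dominated
  convergence upgrades this to convergence in the \<open>L\<^sup>1\<close>-norm.\<close>

section \<open>Differentiability almost everywhere\<close>

text \<open>The obstacle is that the Lipschitz constants of the approximating inputs cannot be kept
  bounded: a jump of \<open>u\<close> is crossed in ever shorter time. Each approximant therefore
  carries two certificates. The increment of \<open>h\<close> bounds its variation, uniformly in the
  index; the constant \<open>K\<close> serves only to solve one equation at a time by Picard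
  iteration and never enters a bound that survives the limit. Such a bound exists because the
  equation is affine in the derivative of the input: with \<open>\<eta>\<close> the density of
  \<open>h\<close>, the right-hand side is at most
  \<open>(1 + \<rho> + norm x) * M * (1 + m * \<eta> t)\<close>, and the integral of
  \<open>\<eta>\<close> is an increment of \<open>h\<close>, however fast the input moves. Lipschitz
  inputs are preferred to merely absolutely continuous ones because their derivatives are bounded;
  that these exist almost everywhere is proved here by Radon-Nikodym. The nodes must catch the
  discontinuities of the variation function, since its increment over a cell is what controls an
  approximant inside that cell. Convergence is sought at every point, not just almost everywhere, so
  that one sequence of inputs serves all \<tau>.\<close>

text \<open>The averages in \<open>integrable_ccontinuous_explicit\<close> run over boxes with lower
  corner \<open>x\<close>, so on the line they are right difference quotients of \<open>F\<close>.
  Multiplying by \<open>h\<close> puts them in the form of \<open>has_derivative_at_alt\<close>; the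
  null set does not depend on \<open>e\<close>.\<close>

lemma integral_right_quotient:
  fixes f :: "real \<Rightarrow> 'a::euclidean_space"
  assumes f: "\<And>c d. c \<le> d \<Longrightarrow> (f has_integral F d - F c) {c..d}"
  obtains N where "negligible N"
    "\<And>x e. x \<notin> N \<Longrightarrow> 0 < e \<Longrightarrow>
       \<exists>d>0. \<forall>h. 0 < h \<and> h < d \<longrightarrow> norm (F (x + h) - F x - h *\<^sub>R f x) \<le> e * h"
proof -
  have int: "f integrable_on cbox c d" for c d
    using f[of c d] by (cases "c \<le> d") (auto simp: integrable_on_def)
  obtain N where N: "negligible N" "\<And>x e. \<lbrakk>x \<notin> N; 0 < e\<rbrakk> \<Longrightarrow> \<exists>d>0. \<forall>h. 0 < h \<and> h < d \<longrightarrow>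
                         norm(integral (cbox x (x + h *\<^sub>R One)) f /\<^sub>R h ^ DIM(real) - f x) < e"
    using integrable_ccontinuous_explicit[of f, OF int] by blast
  show thesis
  proof (rule that[OF N(1)])
    fix x e :: real assume "x \<notin> N" "0 < e"
    then obtain d where d: "d > 0" "\<And>h. 0 < h \<and> h < d \<Longrightarrow>
        norm(integral (cbox x (x + h *\<^sub>R One)) f /\<^sub>R h ^ DIM(real) - f x) < e"
      using N(2) by blast
    have "norm (F (x + h) - F x - h *\<^sub>R f x) \<le> e * h" if h: "0 < h \<and> h < d" for h
    proof -
      have "integral (cbox x (x + h *\<^sub>R One)) f = F (x + h) - F x"
        using f[of x "x + h"] h by (auto intro: integral_unique)
      then have *: "norm ((F (x + h) - F x) /\<^sub>R h - f x) < e" using d(2)[OF h] by simp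
      have "F (x + h) - F x - h *\<^sub>R f x = h *\<^sub>R ((F (x + h) - F x) /\<^sub>R h - f x)"
        using h by (simp add: scaleR_diff_right)
      then have "norm (F (x + h) - F x - h *\<^sub>R f x) = h * norm ((F (x + h) - F x) /\<^sub>R h - f x)"
        using h by (metis abs_of_pos norm_scaleR)
      also have "\<dots> \<le> h * e" using * h by (intro mult_left_mono) auto
      finally show ?thesis by (simp add: mult.commute)
    qed
    then show "\<exists>d>0. \<forall>h. 0 < h \<and> h < d \<longrightarrow> norm (F (x + h) - F x - h *\<^sub>R f x) \<le> e * h"
      using d(1) by blast
  qed
qed

text \<open>The reflection of the line turns left quotients into right ones: the one-sided lemma is
  applied to \<open>F\<close> and once more to the reflected density, whose primitive at
  \<open>x\<close> is \<open>- F (- x)\<close>.\<close>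

lemma lebesgue_differentiation_real:
  fixes f :: "real \<Rightarrow> 'a::euclidean_space"
  assumes f: "\<And>c d. c \<le> d \<Longrightarrow> (f has_integral F d - F c) {c..d}"
  shows "AE t in lebesgue. (F has_vector_derivative f t) (at t)"
proof -
  have f': "((\<lambda>x. f (- x)) has_integral (- F (- d)) - (- F (- c))) {c..d}" if "c \<le> d" for c d
    using has_integral_reflect_real[of f "F (-c) - F (-d)" "-c" "-d"] f[of "-d" "-c"] that by simp
  obtain N1 where N1: "negligible N1" "\<And>x e. x \<notin> N1 \<Longrightarrow> 0 < e \<Longrightarrow>
       \<exists>d>0. \<forall>h. 0 < h \<and> h < d \<longrightarrow> norm (F (x + h) - F x - h *\<^sub>R f x) \<le> e * h"
    using integral_right_quotient[of f F, OF f] by blast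
  obtain N2 where N2: "negligible N2" "\<And>x e. x \<notin> N2 \<Longrightarrow> 0 < e \<Longrightarrow>
       \<exists>d>0. \<forall>h. 0 < h \<and> h < d \<longrightarrow> norm (- F (- (x + h)) - - F (- x) - h *\<^sub>R f (- x)) \<le> e * h"
    using integral_right_quotient[of "\<lambda>x. f (- x)" "\<lambda>x. - F (- x)", OF f'] by blast
  have "negligible (uminus ` N2)"
    using N2(1) by (rule negligible_differentiable_image_negligible[OF order_refl]) (auto intro!: derivative_intros)
  then have null: "N1 \<union> uminus ` N2 \<in> null_sets lebesgue"
    using N1(1) by (simp flip: negligible_iff_null_sets)
  have "(F has_vector_derivative f t) (at t)" if t: "t \<notin> N1 \<union> uminus ` N2" for t
    unfolding has_vector_derivative_def has_derivative_at_alt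
  proof (intro conjI allI impI)
    show "bounded_linear (\<lambda>x. x *\<^sub>R f t)" by (rule bounded_linear_scaleR_left)
    fix e :: real assume e: "e > 0"
    have tN: "t \<notin> N1" "- t \<notin> N2" using t by (auto simp: image_iff)
    obtain d1 where d1: "d1 > 0" "\<And>h. 0 < h \<Longrightarrow> h < d1 \<Longrightarrow> norm (F (t + h) - F t - h *\<^sub>R f t) \<le> e * h"
      using N1(2)[OF tN(1) e] by blast
    obtain d2 where d2: "d2 > 0" "\<And>h. 0 < h \<Longrightarrow> h < d2 \<Longrightarrow>
        norm (- F (- (- t + h)) - - F (- (- t)) - h *\<^sub>R f (- (- t))) \<le> e * h"
      using N2(2)[OF tN(2) e] by blast
    have "norm (F y - F t - (y - t) *\<^sub>R f t) \<le> e * norm (y - t)" if y: "norm (y - t) < min d1 d2" for y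
    proof (cases y t rule: linorder_cases)
      case less
      have eq: "F t - F y - (t - y) *\<^sub>R f t = - (F y - F t - (y - t) *\<^sub>R f t)"
        by (simp add: algebra_simps)
      have "norm (F t - F y - (t - y) *\<^sub>R f t) \<le> e * (t - y)"
        using d2(2)[of "t - y"] less y by simp
      then show ?thesis unfolding eq norm_minus_cancel using less by simp
    next
      case greater
      then show ?thesis using d1(2)[of "y - t"] y by simp
    qed auto
    then show "\<exists>d>0. \<forall>y. norm (y - t) < d \<longrightarrow> norm (F y - F t - (y - t) *\<^sub>R f t) \<le> e * norm (y - t)"
      using d1(1) d2(1) by (intro exI[of _ "min d1 d2"]) auto
  qed
  then show ?thesis by (intro AE_I'[OF null]) auto
qed

section \<open>Lipschitz functions on the line as integrals of their derivatives\<close>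

text \<open>The lower slope bound makes \<open>F\<close> a bijection of the line with 1-Lipschitz
  inverse \<open>\<phi>\<close>. The image of Lebesgue measure under \<open>\<phi>\<close> gives a
  set the measure of its image under \<open>F\<close>; it is absolutely continuous because Lipschitz
  maps preserve null sets. Its Radon-Nikodym density is the desired \<open>w\<close>, as
  \<open>F\<close> maps \<open>{c..d}\<close> onto \<open>{F c..F d}\<close>.\<close>

lemma strict_expanding_density:
  fixes F :: "real \<Rightarrow> real"
  assumes low: "\<And>s t. s \<le> t \<Longrightarrow> t - s \<le> F t - F s"
    and up: "\<And>s t. s \<le> t \<Longrightarrow> F t - F s \<le> L * (t - s)"
  obtains w where "w \<in> borel_measurable borel" "\<And>t. 0 \<le> w t"
    "\<And>c d. c \<le> d \<Longrightarrow> (w has_integral F d - F c) {c..d}"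
proof -
  have abs_low: "\<bar>t - s\<bar> \<le> \<bar>F t - F s\<bar>" for s t
    using low[of s t] low[of t s] by linarith
  have abs_up: "\<bar>F t - F s\<bar> \<le> L * \<bar>t - s\<bar>" for s t
    using up[of s t] up[of t s] low[of s t] low[of t s] by (cases "s \<le> t") (auto simp: abs_if)
  have L: "L \<ge> 0" using up[of 0 1] low[of 0 1] by simp
  have lip: "L-lipschitz_on UNIV F"
    using abs_up L by (intro lipschitz_onI) (auto simp: dist_real_def)
  have cont: "continuous_on S F" for S
    using lipschitz_on_continuous_on[OF lip] continuous_on_subset by blast
  have mono_iff: "F s \<le> F t \<longleftrightarrow> s \<le> t" for s t
    using low[of s t] low[of t s] by linarith
  have inj: "inj F" using mono_iff by (metis injI order_antisym order_refl)
  have surj: "\<exists>x. F x = y" for y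
  proof -
    define r where "r = \<bar>y - F 0\<bar>"
    have "F (- r) \<le> y" "y \<le> F r" using low[of "-r" 0] low[of 0 r] by (auto simp: r_def)
    then show ?thesis using IVT'[of F "-r" y r] cont by (auto simp: r_def)
  qed
  define \<phi> where "\<phi> = inv F"
  have F\<phi>: "F (\<phi> y) = y" for y using surj unfolding \<phi>_def by (metis f_inv_into_f rangeI)
  have \<phi>F: "\<phi> (F x) = x" for x using inj by (simp add: \<phi>_def)
  have "1-lipschitz_on UNIV \<phi>"
    using abs_low[of "\<phi> _" "\<phi> _"] by (intro lipschitz_onI) (auto simp: dist_real_def F\<phi>)
  then have \<phi>m [measurable]: "\<phi> \<in> borel_measurable borel"
    by (intro borel_measurable_continuous_onI lipschitz_on_continuous_on)
  define \<mu> where "\<mu> = distr lborel borel \<phi>"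
  have vim: "\<phi> -` A = F ` A" for A :: "real set"
    using F\<phi> \<phi>F by (auto simp: image_iff) metis
  have ac: "absolutely_continuous lborel \<mu>"
    unfolding absolutely_continuous_def
  proof
    fix A :: "real set" assume A: "A \<in> null_sets lborel"
    then have "negligible A"
      by (simp add: negligible_iff_null_sets null_sets_completionI)
    then have "negligible (F ` A)"
    proof (rule negligible_locally_Lipschitz_image[OF order_refl])
      show "\<exists>T B. open T \<and> x \<in> T \<and> (\<forall>y\<in>A \<inter> T. norm (F y - F x) \<le> B * norm (y - x))" for x
        by (rule exI[of _ UNIV], rule exI[of _ L]) (simp add: abs_up)
    qed
    moreover have "F ` A \<in> sets borel"
      using measurable_sets[OF \<phi>m, of A] A by (simp add: vim null_sets_def)
    ultimately have "F ` A \<in> null_sets lborel"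
      by (simp add: negligible_iff_null_sets null_sets_completion_iff)
    then show "A \<in> null_sets \<mu>"
      using A by (auto simp: \<mu>_def null_sets_def emeasure_distr vim)
  qed
  have "sets \<mu> = sets lborel" by (simp add: \<mu>_def)
  then obtain f where f [measurable]: "f \<in> borel_measurable lborel" and dens: "density lborel f = \<mu>"
    using sigma_finite_measure.Radon_Nikodym[OF sigma_finite_lborel ac] by blast
  have f_int: "(\<integral>\<^sup>+x\<in>{c..d}. f x \<partial>lborel) = ennreal (F d - F c)" if "c \<le> d" for c d
  proof -
    have "(\<integral>\<^sup>+x\<in>{c..d}. f x \<partial>lborel) = emeasure \<mu> {c..d}"
      by (simp flip: dens add: emeasure_density)
    also have "\<dots> = emeasure lborel (\<phi> -` {c..d})" by (simp add: \<mu>_def emeasure_distr)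
    also have "\<phi> -` {c..d} = {F c..F d}"
      using mono_iff[of c "\<phi> _"] mono_iff[of "\<phi> _" d] by (auto simp: F\<phi>)
    finally show ?thesis using that by (simp add: mono_iff)
  qed
  \<comment> \<open>The density may take the value infinity, which \<open>enn2real\<close> sends to
    0; this is harmless, since its integral over each \<open>{c..d}\<close> is finite.\<close>
  define w where "w = (\<lambda>x. enn2real (f x))"
  have wm [measurable]: "w \<in> borel_measurable borel" unfolding w_def using f by simp
  have int: "(w has_integral F d - F c) {c..d}" if cd: "c \<le> d" for c d
  proof -
    have "AE x in lborel. f x * indicator {c..d} x \<noteq> \<infinity>"
      by (rule nn_integral_PInf_AE) (auto simp: f_int[OF cd])
    then have "(\<integral>\<^sup>+x. ennreal (w x * indicator {c..d} x) \<partial>lborel) = (\<integral>\<^sup>+x\<in>{c..d}. f x \<partial>lborel)"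
      by (intro nn_integral_cong_AE, elim eventually_mono)
        (auto simp: w_def indicator_def ennreal_enn2real less_top)
    then have "((\<lambda>x. w x * indicator {c..d} x) has_integral F d - F c) UNIV"
      using cd by (intro nn_integral_has_integral) (auto simp: f_int w_def mono_iff)
    moreover have "(\<lambda>x. w x * indicator {c..d} x) = (\<lambda>x. if x \<in> {c..d} then w x else 0)"
      by (auto simp: indicator_def)
    ultimately have "((\<lambda>x. if x \<in> {c..d} then w x else 0) has_integral F d - F c) UNIV" by argo
    then show ?thesis by (rule iffD1[OF has_integral_restrict_UNIV])
  qed
  show thesis by (rule that[OF wm _ int]) (simp_all add: w_def)
qed

text \<open>Adding the linear function with slope \<open>L + 1\<close> lifts all slopes into the
  range from 1 to \<open>2 * L + 1\<close>, where the expanding case applies; the constant is then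
  subtracted from the density.\<close>

lemma rademacher_real:
  fixes F :: "real \<Rightarrow> real"
  assumes lip: "\<And>s t. s \<le> t \<Longrightarrow> \<bar>F t - F s\<bar> \<le> L * (t - s)"
  shows "\<exists>w\<in>borel_measurable borel. (\<forall>c d. c \<le> d \<longrightarrow> (w has_integral F d - F c) {c..d}) \<and>
    (AE t in lebesgue. (F has_vector_derivative w t) (at t))"
proof -
  define G where "G = (\<lambda>t. F t + (L + 1) * t)"
  have "t - s \<le> G t - G s" "G t - G s \<le> (2 * L + 1) * (t - s)" if "s \<le> t" for s t
    using lip[OF that] by (auto simp: G_def algebra_simps abs_le_iff)
  then obtain w where w: "w \<in> borel_measurable borel" "\<And>c d. c \<le> d \<Longrightarrow> (w has_integral G d - G c) {c..d}"
    using strict_expanding_density[of G "2 * L + 1"] by metis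
  have int: "((\<lambda>t. w t - (L + 1)) has_integral F d - F c) {c..d}" if "c \<le> d" for c d
    using has_integral_diff[OF w(2)[OF that] has_integral_const_real[of "L + 1" c d]] that
    by (simp add: G_def algebra_simps)
  show ?thesis
  proof (intro bexI conjI allI impI)
    show "(\<lambda>t. w t - (L + 1)) \<in> borel_measurable borel" using w(1) by measurable
  qed (use int lebesgue_differentiation_real[OF int] in auto)
qed

text \<open>A single right difference quotient suffices: at a common small step \<open>r\<close>
  each derivative is approximated with error \<open>e / 2\<close>, and domination compares the two
  increments.\<close>

lemma norm_derivative_le_of_dominated:
  fixes u :: "real \<Rightarrow> 'a::real_normed_vector"
  assumes u: "(u has_vector_derivative p) (at t)" and h: "(h has_vector_derivative q) (at t)"
    and dom: "\<And>y. t \<le> y \<Longrightarrow> norm (u y - u t) \<le> h y - h t"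
  shows "norm p \<le> (q::real)"
proof (rule field_le_epsilon)
  fix e :: real assume "e > 0"
  then have e: "e / 2 > 0" by simp
  obtain d1 where d1: "d1 > 0" "\<And>y. norm (y - t) < d1 \<Longrightarrow> norm (u y - u t - (y - t) *\<^sub>R p) \<le> e / 2 * norm (y - t)"
    using u e unfolding has_vector_derivative_def has_derivative_at_alt by blast
  obtain d2 where d2: "d2 > 0" "\<And>y. norm (y - t) < d2 \<Longrightarrow> norm (h y - h t - (y - t) *\<^sub>R q) \<le> e / 2 * norm (y - t)"
    using h e unfolding has_vector_derivative_def has_derivative_at_alt by blast
  define r where "r = min d1 d2 / 2"
  have r: "r > 0" "r < d1" "r < d2" using d1(1) d2(1) by (auto simp: r_def min_def)
  have 1: "norm (u (t + r) - u t - r *\<^sub>R p) \<le> e / 2 * r" using d1(2)[of "t + r"] r by simp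
  have "\<bar>h (t + r) - h t - r * q\<bar> \<le> e / 2 * r" using d2(2)[of "t + r"] r by simp
  then have 2: "h (t + r) - h t - r * q \<le> e / 2 * r" by linarith
  have "r * norm p = norm (r *\<^sub>R p)" using r by simp
  also have "\<dots> \<le> norm (u (t + r) - u t) + norm (u (t + r) - u t - r *\<^sub>R p)"
    using norm_triangle_ineq4[of "u (t + r) - u t" "u (t + r) - u t - r *\<^sub>R p"] by simp
  also have "\<dots> \<le> (r * q + e / 2 * r) + e / 2 * r"
    using dom[of "t + r"] r 1 2 by simp
  also have "\<dots> = r * (q + e)" by (simp add: algebra_simps)
  finally show "norm p \<le> q + e" using r by simp
qed

text \<open>Turns domination of increments into domination of speeds. The bounds on
  \<open>du\<close> and \<open>\<eta>\<close> hold at every point and not just almost everywhere,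
  because the Picard lemma asks for its Lipschitz and growth bounds at each time.\<close>

lemma dominated_path_derivative:
  fixes u :: "real \<Rightarrow> 'a::euclidean_space"
  assumes dom: "\<And>s t. s \<le> t \<Longrightarrow> norm (u t - u s) \<le> h t - h s"
    and lip: "\<And>s t. s \<le> t \<Longrightarrow> h t - h s \<le> K * (t - s)"
  obtains du \<eta> where "du \<in> borel_measurable borel" "\<eta> \<in> borel_measurable borel"
    "\<And>t. norm (du t) \<le> \<eta> t" "\<And>t. \<eta> t \<le> K"
    "\<And>c d. c \<le> d \<Longrightarrow> (\<eta> has_integral h d - h c) {c..d}"
    "AE t in lebesgue. (u has_vector_derivative du t) (at t)"
proof -
  have K: "K \<ge> 0" using order_trans[OF order_trans[OF norm_ge_zero dom] lip, of 0 1] by simp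
  have h_mono: "h s \<le> h t" if "s \<le> t" for s t using dom[OF that] norm_ge_zero[of "u t - u s"] by linarith
  have h_lip: "\<bar>h t - h s\<bar> \<le> K * (t - s)" if "s \<le> t" for s t
    using lip[OF that] h_mono[OF that] by simp
  obtain \<eta>0 where \<eta>0: "\<eta>0 \<in> borel_measurable borel" "\<And>c d. c \<le> d \<Longrightarrow> (\<eta>0 has_integral h d - h c) {c..d}"
    "AE t in lebesgue. (h has_vector_derivative \<eta>0 t) (at t)"
    using rademacher_real[of h K, OF h_lip] by blast
  have "\<exists>w. w \<in> borel_measurable borel \<and> (AE t in lebesgue. ((\<lambda>t. u t \<bullet> i) has_vector_derivative w t) (at t))"
    if i: "i \<in> Basis" for i
  proof -
    have u_lip: "\<bar>u t \<bullet> i - u s \<bullet> i\<bar> \<le> K * (t - s)" if "s \<le> t" for s t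
      using Basis_le_norm[OF i, of "u t - u s"] dom[OF that] lip[OF that] by (simp add: inner_diff_left)
    show ?thesis using rademacher_real[of "\<lambda>t. u t \<bullet> i" K, OF u_lip] by blast
  qed
  then obtain W where W: "\<And>i. i \<in> Basis \<Longrightarrow> W i \<in> borel_measurable borel"
    "\<And>i. i \<in> Basis \<Longrightarrow> AE t in lebesgue. ((\<lambda>t. u t \<bullet> i) has_vector_derivative W i t) (at t)"
    by metis
  define du0 where "du0 = (\<lambda>t. \<Sum>i\<in>Basis. W i t *\<^sub>R i)"
  have du0m: "du0 \<in> borel_measurable borel" unfolding du0_def using W(1) by (intro borel_measurable_sum) auto
  have "AE t in lebesgue. \<forall>i\<in>Basis. ((\<lambda>t. u t \<bullet> i) has_vector_derivative W i t) (at t)"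
    using W(2) by (intro AE_finite_allI) auto
  then have good: "AE t in lebesgue. (u has_vector_derivative du0 t) (at t) \<and> norm (du0 t) \<le> \<eta>0 t \<and> \<eta>0 t \<le> K"
    using \<eta>0(3)
  proof eventually_elim
    case (elim t)
    have "((\<lambda>t. \<Sum>i\<in>Basis. (u t \<bullet> i) *\<^sub>R i) has_vector_derivative du0 t) (at t)"
      unfolding du0_def using elim(1)
      by (intro has_vector_derivative_sum) (auto simp: has_real_derivative_iff_has_vector_derivative intro!: derivative_eq_intros)
    then have du: "(u has_vector_derivative du0 t) (at t)" by (simp add: euclidean_representation)
    have "norm (du0 t) \<le> \<eta>0 t"
      by (rule norm_derivative_le_of_dominated[OF du elim(2)]) (rule dom)
    moreover have "norm (\<eta>0 t) \<le> K"
    proof (rule norm_derivative_le_of_dominated[OF elim(2)])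
      show "((*) K has_vector_derivative K) (at t)"
        by (auto simp flip: has_real_derivative_iff_has_vector_derivative intro!: derivative_eq_intros)
    qed (use lip h_mono in \<open>auto simp: right_diff_distrib\<close>)
    ultimately show ?case using du by auto
  qed
  \<comment> \<open>Truncating the density to the range from 0 to \<open>K\<close>, and cancelling
    the derivative where it exceeds the truncated density, changes both only on a null set and makes
    the inequalities hold everywhere.\<close>
  define \<eta> where "\<eta> = (\<lambda>t. max 0 (min K (\<eta>0 t)))"
  define du where "du = (\<lambda>t. if norm (du0 t) \<le> \<eta> t then du0 t else 0)"
  have \<eta>m: "\<eta> \<in> borel_measurable borel" unfolding \<eta>_def using \<eta>0(1) by simp
  have dum: "du \<in> borel_measurable borel" unfolding du_def
    using \<eta>m du0m by measurable
  have \<eta>eq: "AE t in lebesgue. \<eta> t = \<eta>0 t \<and> du t = du0 t"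
    using good
  proof eventually_elim
    case (elim t)
    then have "\<eta>0 t \<ge> 0" using norm_ge_zero[of "du0 t"] by linarith
    then show ?case using elim by (auto simp: \<eta>_def du_def)
  qed
  then obtain N where N: "{t. \<not> (\<eta> t = \<eta>0 t \<and> du t = du0 t)} \<subseteq> N" "N \<in> null_sets lebesgue"
    unfolding eventually_ae_filter by auto
  have int: "(\<eta> has_integral h d - h c) {c..d}" if "c \<le> d" for c d
    by (rule has_integral_spike[OF _ _ \<eta>0(2)[OF that], of N]) (use N in \<open>auto simp: negligible_iff_null_sets\<close>)
  show thesis
  proof (rule that[OF dum \<eta>m _ _ int])
    show "AE t in lebesgue. (u has_vector_derivative du t) (at t)"
      using good \<eta>eq by eventually_elim auto
  qed (use K in \<open>auto simp: du_def \<eta>_def\<close>)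
qed

text \<open>The map \<open>z\<close> is approximated by maps with countably many values:
  \<open>ix k t\<close> is the first index at which a dense sequence comes within
  \<open>1 / (k + 1)\<close> of \<open>z t\<close>. The composition is measurable for each such map,
  and continuity in the second argument passes to the limit. The dense sequence is taken inside
  \<open>S\<close>, where alone the assumptions on \<open>F\<close> hold.\<close>

lemma caratheodory_measurable:
  fixes F :: "'t \<Rightarrow> 'z::{second_countable_topology, metric_space} \<Rightarrow> 'w::metric_space"
  assumes meas: "\<And>z. z \<in> S \<Longrightarrow> (\<lambda>t. F t z) \<in> borel_measurable M"
    and cont: "\<And>t. t \<in> space M \<Longrightarrow> continuous_on S (F t)"
    and z [measurable]: "z \<in> borel_measurable M" and zS: "\<And>t. t \<in> space M \<Longrightarrow> z t \<in> S"
  shows "(\<lambda>t. F t (z t)) \<in> borel_measurable M"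
proof (cases "S = {}")
  case True
  then have "space M = {}" using zS by auto
  then show ?thesis by (auto simp: measurable_def sets_eq_bot space_empty_iff)
next
  case False
  obtain D where D: "countable D" "D \<subseteq> S" "S \<subseteq> closure D" using separable by blast
  then have D0: "D \<noteq> {}" using False by auto
  define d where "d = from_nat_into D"
  have dS: "d n \<in> S" for n using from_nat_into[OF D0] D(2) by (auto simp: d_def)
  have dense: "\<exists>n. dist (d n) (z t) < inverse (real (Suc k))" if "t \<in> space M" for t k
  proof -
    have "z t \<in> closure D" using zS[OF that] D(3) by auto
    then obtain y where "y \<in> D" "dist y (z t) < inverse (real (Suc k))"
      unfolding closure_approachable by (metis inverse_positive_iff_positive of_nat_0_less_iff zero_less_Suc)
    then show ?thesis using D(1) by (metis d_def from_nat_into_surj)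
  qed
  define ix where "ix = (\<lambda>k t. LEAST n. dist (d n) (z t) < inverse (real (Suc k)))"
  have ix_m: "ix k \<in> measurable M (count_space UNIV)" for k
    unfolding ix_def by measurable
  have ix: "dist (d (ix k t)) (z t) < inverse (real (Suc k))" if "t \<in> space M" for k t
    unfolding ix_def using dense[OF that] by (rule LeastI_ex)
  show ?thesis
  proof (rule borel_measurable_LIMSEQ_metric)
    show "(\<lambda>t. F t (d (ix k t))) \<in> borel_measurable M" for k
      by (rule measurable_compose_countable[OF _ ix_m]) (rule meas[OF dS])
    fix t assume t: "t \<in> space M"
    have "(\<lambda>k. d (ix k t)) \<longlonglongrightarrow> z t"
    proof (rule metric_tendsto_imp_tendsto[OF LIMSEQ_inverse_real_of_nat])
      show "\<forall>\<^sub>F k in sequentially. dist (d (ix k t)) (z t) \<le> dist (inverse (real (Suc k))) 0"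
        using ix[OF t] by (intro always_eventually allI) (simp add: less_imp_le)
    qed
    then show "(\<lambda>k. F t (d (ix k t))) \<longlonglongrightarrow> F t (z t)"
      by (rule continuous_on_tendsto_compose[OF cont[OF t]]) (simp_all add: zS[OF t] dS)
  qed
qed

section \<open>Solutions of the Cauchy problem\<close>

lemma integrable_on_bounded_measurable:
  fixes f :: "real \<Rightarrow> 'a::euclidean_space"
  assumes m: "f \<in> borel_measurable (lebesgue_on {a..b})" and s: "{c..d} \<subseteq> {a..b}"
    and bd: "\<And>t. t \<in> {a..b} \<Longrightarrow> norm (f t) \<le> B"
  shows "f absolutely_integrable_on {c..d}"
proof -
  have "f \<in> borel_measurable (lebesgue_on {c..d})"
    using measurable_restrict_mono[OF m s] .
  then show ?thesis
    by (rule measurable_bounded_by_integrable_imp_absolutely_integrable[where g = "\<lambda>_. B"])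
      (use s bd in auto)
qed

text \<open>Banach's fixed point theorem in Bielecki's weighted norm: with an exponential weight the
  integral operator contracts on the whole interval at once, so no short intervals have to be
  patched. The integral form is used because \<open>G\<close> is only measurable in time.\<close>

lemma picard_integral_equation:
  fixes G :: "real \<Rightarrow> 'a::euclidean_space \<Rightarrow> 'a"
  assumes ab: "a \<le> b"
    and meas: "\<And>y. continuous_on {a..b} y \<Longrightarrow> (\<lambda>t. G t (y t)) \<in> borel_measurable (lebesgue_on {a..b})"
    and lip: "\<And>t x y. t \<in> {a..b} \<Longrightarrow> norm (G t x - G t y) \<le> K * norm (x - y)"
    and bd: "\<And>t x. t \<in> {a..b} \<Longrightarrow> norm (G t x) \<le> B"
  obtains x where "continuous_on {a..b} x" "x a = x0"
    "\<And>s t. a \<le> s \<Longrightarrow> s \<le> t \<Longrightarrow> t \<le> b \<Longrightarrow> ((\<lambda>\<tau>. G \<tau> (x \<tau>)) has_integral x t - x s) {s..t}"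
proof -
  define k where "k = max K 1"
  have k: "k > 0" by (simp add: k_def)
  have lip': "norm (G t x - G t y) \<le> k * norm (x - y)" if "t \<in> {a..b}" for t x y
    using order_trans[OF lip[OF that] mult_right_mono[of K k "norm (x - y)"]] by (simp add: k_def)
  have int: "(\<lambda>\<tau>. G \<tau> (y \<tau>)) integrable_on {s..t}" if "continuous_on {a..b} y" "a \<le> s" "t \<le> b" for y s t
    using integrable_on_bounded_measurable[OF meas[OF that(1)], of s t B] that(2,3) bd
    by (auto intro: set_lebesgue_integral_eq_integral)
  \<comment> \<open>The unknown is \<open>y = x / e\<close>, so that the ordinary sup norm of
    \<open>y\<close> is the weighted norm of \<open>x\<close>. As the integral of
    \<open>k * e\<close> is at most \<open>e / 2\<close>, the exponent \<open>2 * k\<close> yields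
    the contraction factor 1/2.\<close>
  define e where "e = (\<lambda>t. exp (2 * k * (t - a)))"
  have e_pos: "e t > 0" for t by (simp add: e_def)
  have e_cont: "continuous_on S e" for S unfolding e_def by (intro continuous_intros)
  \<comment> \<open>Bounded continuous functions form a complete space on the whole line here;
    clamping time to \<open>{a..b}\<close> makes the operator act on them.\<close>
  define cl where "cl = (\<lambda>t. max a (min b t))"
  have cl: "cl t \<in> {a..b}" "t \<in> {a..b} \<Longrightarrow> cl t = t" for t using ab by (auto simp: cl_def)
  have cl_cont: "continuous_on UNIV cl" unfolding cl_def by (intro continuous_intros)
  define J where "J = (\<lambda>y t. x0 + integral {a..t} (\<lambda>s. G s (e s *\<^sub>R y s)))"
  define T where "T = (\<lambda>(y :: real \<Rightarrow>\<^sub>C 'a) t. (1 / e (cl t)) *\<^sub>R J y (cl t))"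
  have cy: "continuous_on {a..b} (\<lambda>s. e s *\<^sub>R apply_bcontfun y s)" for y :: "real \<Rightarrow>\<^sub>C 'a"
    using e_cont by (intro continuous_intros) auto
  have J_cont: "continuous_on {a..b} (J y)" for y :: "real \<Rightarrow>\<^sub>C 'a"
    unfolding J_def using int[OF cy, of a b] by (intro continuous_intros indefinite_integral_continuous_1) auto
  have Q_cont: "continuous_on {a..b} (\<lambda>t. (1 / e t) *\<^sub>R J y t)" for y :: "real \<Rightarrow>\<^sub>C 'a"
    using e_cont e_pos J_cont by (intro continuous_intros) (auto simp: less_imp_neq[symmetric])
  have T_bcont: "T y \<in> bcontfun" for y
  proof -
    have "bounded ((\<lambda>t. (1 / e t) *\<^sub>R J y t) ` {a..b})"
      by (intro compact_imp_bounded compact_continuous_image Q_cont) simp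
    then obtain C where C: "\<And>t. t \<in> {a..b} \<Longrightarrow> norm ((1 / e t) *\<^sub>R J y t) \<le> C"
      unfolding bounded_iff by blast
    show ?thesis
    proof (rule bcontfun_normI)
      show "continuous_on UNIV (T y)"
        unfolding T_def by (rule continuous_on_compose2[OF Q_cont cl_cont]) (use cl in auto)
      show "norm (T y t) \<le> C" for t
        unfolding T_def using C[OF cl(1)] .
    qed
  qed
  have contr: "norm (T y t - T z t) \<le> 1 / 2 * dist y z" for y z t
  proof -
    define r where "r = cl t"
    have r: "a \<le> r" "r \<le> b" using cl(1)[of t] by (auto simp: r_def)
    have "J y r - J z r = integral {a..r} (\<lambda>s. G s (e s *\<^sub>R y s)) - integral {a..r} (\<lambda>s. G s (e s *\<^sub>R z s))"
      by (simp add: J_def)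
    also have "\<dots> = integral {a..r} (\<lambda>s. G s (e s *\<^sub>R y s) - G s (e s *\<^sub>R z s))"
      by (rule integral_diff[symmetric]) (use int[OF cy] r in auto)
    finally have J_diff: "J y r - J z r = \<dots>" .
    have e_int: "((\<lambda>s. k * dist y z * e s) has_integral dist y z / 2 * e r - dist y z / 2 * e a) {a..r}"
      by (rule fundamental_theorem_of_calculus[OF r(1)])
        (auto simp: e_def simp flip: has_real_derivative_iff_has_vector_derivative intro!: derivative_eq_intros)
    have "norm (J y r - J z r) \<le> integral {a..r} (\<lambda>s. k * dist y z * e s)"
      unfolding J_diff
    proof (rule integral_norm_bound_integral)
      show "(\<lambda>s. G s (e s *\<^sub>R y s) - G s (e s *\<^sub>R z s)) integrable_on {a..r}"
        using int[OF cy] r by (intro integrable_diff) auto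
      show "(\<lambda>s. k * dist y z * e s) integrable_on {a..r}" using e_int by blast
      fix s assume s: "s \<in> {a..r}"
      then have "norm (G s (e s *\<^sub>R y s) - G s (e s *\<^sub>R z s)) \<le> k * norm (e s *\<^sub>R y s - e s *\<^sub>R z s)"
        using r by (intro lip') auto
      also have "\<dots> = k * (e s * dist (y s) (z s))"
        using e_pos[of s] by (simp add: dist_norm flip: scaleR_diff_right)
      also have "\<dots> \<le> k * (e s * dist y z)"
        using k e_pos[of s] dist_bounded[of y s z] by (intro mult_left_mono) auto
      finally show "norm (G s (e s *\<^sub>R y s) - G s (e s *\<^sub>R z s)) \<le> k * dist y z * e s"
        by (simp add: algebra_simps)
    qed
    also have "\<dots> = dist y z / 2 * e r - dist y z / 2 * e a" using e_int by (rule integral_unique)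
    also have "\<dots> \<le> dist y z / 2 * e r" using e_pos[of a] by simp
    finally have le: "norm (J y r - J z r) \<le> dist y z / 2 * e r" .
    have "norm (T y t - T z t) = norm (J y r - J z r) / e r"
      using e_pos[of r] by (simp add: T_def r_def flip: scaleR_diff_right)
    also have "\<dots> \<le> dist y z / 2" using le e_pos[of r] by (simp add: divide_le_eq)
    finally show ?thesis by simp
  qed
  have "\<exists>!y\<in>UNIV. Bcontfun (T y) = y"
  proof (rule Banach_fix[where c = "1/2"])
    fix y z :: "real \<Rightarrow>\<^sub>C 'a"
    have "dist (Bcontfun (T y)) (Bcontfun (T z)) \<le> 1 / 2 * dist y z"
      by (rule dist_bound) (use contr[of y _ z] in \<open>auto simp: dist_norm Bcontfun_inverse T_bcont\<close>)
    then show "dist (Bcontfun (T y)) (Bcontfun (T z)) \<le> 1 / 2 * dist y z" .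
  qed (auto simp: complete_UNIV)
  then obtain y where "Bcontfun (T y) = y" by blast
  then have Ty: "apply_bcontfun y = T y" using Bcontfun_inverse[OF T_bcont] by metis
  define x where "x = (\<lambda>t. e t *\<^sub>R apply_bcontfun y t)"
  have xJ: "x t = J y t" if "t \<in> {a..b}" for t
  proof -
    have "apply_bcontfun y t = (1 / e t) *\<^sub>R J y t"
      using fun_cong[OF Ty, of t] by (simp only: T_def cl(2)[OF that])
    then show ?thesis using e_pos[of t] by (simp add: x_def)
  qed
  have xc: "continuous_on {a..b} x" unfolding x_def by (rule cy)
  show thesis
  proof (rule that[OF xc])
    show "x a = x0" using xJ[of a] ab by (simp add: J_def)
    fix s t assume st: "a \<le> s" "s \<le> t" "t \<le> b"
    have x_eq: "x r = x0 + integral {a..r} (\<lambda>s. G s (x s))" if "r \<in> {a..b}" for r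
      using xJ[OF that] by (simp add: J_def x_def)
    have "integral {a..s} (\<lambda>s. G s (x s)) + integral {s..t} (\<lambda>s. G s (x s)) = integral {a..t} (\<lambda>s. G s (x s))"
      using st int[OF xc, of a t] by (intro Henstock_Kurzweil_Integration.integral_combine) auto
    then have "integral {s..t} (\<lambda>\<tau>. G \<tau> (x \<tau>)) = x t - x s"
      using x_eq[of s] x_eq[of t] st by (simp add: algebra_simps)
    then show "((\<lambda>\<tau>. G \<tau> (x \<tau>)) has_integral x t - x s) {s..t}"
      using int[OF xc, of s t] st by (simp add: has_integral_iff)
  qed
qed

text \<open>A Gronwall estimate without exponentials: on a stretch over which \<open>H\<close> grows by at most
  one half, \<open>w\<close> at most doubles, because half of its maximum can be absorbed.\<close>

lemma doubling_estimate:
  fixes w H :: "real \<Rightarrow> real"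
  assumes w: "continuous_on {a..b} w" and H: "continuous_on {a..b} H"
    and step: "\<And>s t m. a \<le> s \<Longrightarrow> s \<le> t \<Longrightarrow> t \<le> b \<Longrightarrow> (\<And>r. r \<in> {s..t} \<Longrightarrow> w r \<le> m) \<Longrightarrow>
      w t \<le> w s + m * (H t - H s)"
    and mono: "\<And>s t. a \<le> s \<Longrightarrow> s \<le> t \<Longrightarrow> t \<le> b \<Longrightarrow> H s \<le> H t"
    and nonneg: "\<And>t. t \<in> {a..b} \<Longrightarrow> 0 \<le> w t"
  shows "t \<in> {a..b} \<Longrightarrow> H t - H a \<le> real n / 2 \<Longrightarrow> w t \<le> 2 ^ n * w a"
proof -
  \<comment> \<open>With \<open>p\<close> a maximum point of \<open>w\<close> on
    \<open>{s..t}\<close>, \<open>step\<close> is applied up to time \<open>p\<close> with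
    \<open>m = w p\<close>, so the maximum is estimated by a multiple of itself.\<close>
  have peak: "\<exists>p. w t \<le> w p \<and> 0 \<le> w p \<and> w p \<le> w s + w p * (H t - H s)"
    if s: "a \<le> s" "s \<le> t" "t \<le> b" for s t
  proof -
    have "continuous_on {s..t} w" using w by (rule continuous_on_subset) (use s in auto)
    then obtain p where p: "p \<in> {s..t}" "\<And>r. r \<in> {s..t} \<Longrightarrow> w r \<le> w p"
      using continuous_attains_sup[of "{s..t}" w] s by auto
    have 0: "0 \<le> w p" using p s by (intro nonneg) auto
    have "w p \<le> w s + w p * (H p - H s)" using p s by (intro step) auto
    also have "\<dots> \<le> w s + w p * (H t - H s)"
      using p s mono[of p t] 0 by (intro add_left_mono mult_left_mono) auto
    finally show ?thesis using p(2)[of t] s 0 by (intro exI[of _ p]) auto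
  qed
  show "t \<in> {a..b} \<Longrightarrow> H t - H a \<le> real n / 2 \<Longrightarrow> w t \<le> 2 ^ n * w a"
  proof (induction n arbitrary: t)
    case 0
    obtain p where p: "w t \<le> w p" "0 \<le> w p" "w p \<le> w a + w p * (H t - H a)"
      using peak[of a t] 0 by auto
    have "w p * (H t - H a) \<le> 0" using p(2) 0 by (intro mult_nonneg_nonpos) auto
    then show ?case using p by simp
  next
    case (Suc n)
    show ?case
    proof (cases "H t - H a \<le> real n / 2")
      case True
      have "w t \<le> 2 ^ n * w a" using Suc True by blast
      also have "\<dots> \<le> 2 ^ Suc n * w a" using nonneg[of a] Suc.prems(1) by auto
      finally show ?thesis .
    next
      case False
      \<comment> \<open>The intermediate value theorem cuts off a last stretch on which
        \<open>H\<close> grows by at most 1/2. There at most half of the peak is absorbed, leaving a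
        factor 2 over \<open>w c\<close>, to which the induction hypothesis applies.\<close>
      have "continuous_on {a..t} H" using H by (rule continuous_on_subset) (use Suc.prems in auto)
      then obtain c where c: "a \<le> c" "c \<le> t" "H c = H a + real n / 2"
        using IVT'[of H a "H a + real n / 2" t] False Suc.prems by auto
      obtain p where p: "w t \<le> w p" "0 \<le> w p" "w p \<le> w c + w p * (H t - H c)"
        using peak[of c t] c Suc.prems by auto
      have "w p * (H t - H c) \<le> w p * (1 / 2)"
        using p(2) c Suc.prems by (intro mult_left_mono) (auto simp: field_simps)
      moreover have "w c \<le> 2 ^ n * w a" using Suc.IH[of c] c Suc.prems by auto
      ultimately show ?thesis using p by simp
    qed
  qed
qed

text \<open>A Lebesgue number argument: balls of half the local radius cover \<open>C\<close>, so
  points closer than \<open>\<delta>\<close> share a full ball, and for points farther apart the sup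
  bound \<open>B\<close> gives slope at most \<open>2 * B / \<delta>\<close>. It is applied to a
  ball times \<open>U\<close>; since \<open>U\<close> need not be convex, local constants cannot be
  chained along segments.\<close>

lemma uniform_lipschitz_on_compact:
  fixes \<phi> :: "'i \<Rightarrow> 'x::metric_space \<Rightarrow> 'y::real_normed_vector"
  assumes C: "compact C"
    and loc: "\<And>x. x \<in> C \<Longrightarrow> \<exists>r>0. \<exists>L. \<forall>i\<in>I. L-lipschitz_on (ball x r) (\<phi> i)"
    and bd: "\<And>i x. i \<in> I \<Longrightarrow> x \<in> C \<Longrightarrow> norm (\<phi> i x) \<le> B"
  obtains K where "K \<ge> 0"
    "\<And>i x y. i \<in> I \<Longrightarrow> x \<in> C \<Longrightarrow> y \<in> C \<Longrightarrow> norm (\<phi> i x - \<phi> i y) \<le> K * dist x y"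
proof -
  obtain r L where rL: "\<And>x. x \<in> C \<Longrightarrow> r x > 0"
    "\<And>x i. x \<in> C \<Longrightarrow> i \<in> I \<Longrightarrow> (L x)-lipschitz_on (ball x (r x)) (\<phi> i)"
    using loc by metis
  obtain D where D: "D \<subseteq> C" "finite D" "C \<subseteq> (\<Union>x\<in>D. ball x (r x / 2))"
    by (rule compactE_image[OF C, of C "\<lambda>x. ball x (r x / 2)"]) (use rL(1) in force)+
  define \<delta> where "\<delta> = Min (insert 1 ((\<lambda>x. r x / 2) ` D))"
  define \<Lambda> where "\<Lambda> = Max (insert 0 (L ` D))"
  have \<delta>: "\<delta> > 0" unfolding \<delta>_def using D rL(1) by (subst Min_gr_iff) auto
  have \<delta>_le: "\<delta> \<le> r x / 2" if "x \<in> D" for x unfolding \<delta>_def using D(2) that by (intro Min_le) auto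
  have \<Lambda>: "\<Lambda> \<ge> 0" unfolding \<Lambda>_def using D(2) by (intro Max_ge) auto
  have \<Lambda>_ge: "L x \<le> \<Lambda>" if "x \<in> D" for x unfolding \<Lambda>_def using D(2) that by (intro Max_ge) auto
  show thesis
  proof (rule that[of "max \<Lambda> (2 * B / \<delta>)"])
    show "max \<Lambda> (2 * B / \<delta>) \<ge> 0" using \<Lambda> by simp
    fix i x y assume i: "i \<in> I" and x: "x \<in> C" and y: "y \<in> C"
    show "norm (\<phi> i x - \<phi> i y) \<le> max \<Lambda> (2 * B / \<delta>) * dist x y"
    proof (cases "dist x y < \<delta>")
      case True
      obtain z where z: "z \<in> D" "dist z x < r z / 2" using D(3) x by auto
      have "dist z y < r z" using \<delta>_le[OF z(1)] z(2) True dist_triangle[of z y x] by linarith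
      moreover have "dist z x < r z" using z(2) rL(1)[of z] z(1) D(1) by auto
      ultimately have "dist (\<phi> i x) (\<phi> i y) \<le> L z * dist x y"
        using rL(2)[of z i] z(1) D(1) i by (intro lipschitz_onD[of "L z" "ball z (r z)"]) auto
      also have "\<dots> \<le> max \<Lambda> (2 * B / \<delta>) * dist x y"
        using \<Lambda>_ge[OF z(1)] by (intro mult_right_mono) auto
      finally show ?thesis by (simp add: dist_norm)
    next
      case False
      have B: "0 \<le> B" using order_trans[OF norm_ge_zero bd[OF i x]] .
      have "norm (\<phi> i x - \<phi> i y) \<le> 2 * B"
        using norm_triangle_ineq4[of "\<phi> i x" "\<phi> i y"] bd[OF i x] bd[OF i y] by linarith
      also have "\<dots> = 2 * B / \<delta> * \<delta>" using \<delta> by simp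
      also have "\<dots> \<le> max \<Lambda> (2 * B / \<delta>) * dist x y"
        using False \<delta> B \<Lambda> by (intro mult_mono) auto
      finally show ?thesis .
    qed
  qed
qed

lemma C1_map_lipschitz:
  fixes g :: "'a::real_normed_vector \<Rightarrow> 'b::real_normed_vector"
  assumes "C1_map g" "compact C" "convex C"
  obtains K where "K \<ge> 0" "\<And>x y. x \<in> C \<Longrightarrow> y \<in> C \<Longrightarrow> norm (g x - g y) \<le> K * norm (x - y)"
proof -
  obtain D where D: "\<And>x. (g has_derivative blinfun_apply (D x)) (at x)" "continuous_on UNIV D"
    using assms(1) unfolding C1_map_def by blast
  have "bounded (D ` C)"
    using assms(2) D(2) by (intro compact_imp_bounded compact_continuous_image) (auto intro: continuous_on_subset)
  then obtain K where K: "\<And>x. x \<in> C \<Longrightarrow> norm (D x) \<le> K"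
    unfolding bounded_iff by blast
  show thesis
  proof (rule that[of "max K 0"])
    fix x y assume "x \<in> C" "y \<in> C"
    then show "norm (g x - g y) \<le> max K 0 * norm (x - y)"
      using K by (intro differentiable_bound[OF assms(3), where f' = "\<lambda>x. blinfun_apply (D x)"])
        (auto intro: has_derivative_at_withinI[OF D(1)] simp flip: norm_blinfun.rep_eq intro: max.coboundedI1)
  qed simp
qed

lemma absolutely_continuous_on_lipschitz:
  fixes h :: "real \<Rightarrow> 'a::real_normed_vector"
  assumes "\<And>s t. s \<in> I \<Longrightarrow> t \<in> I \<Longrightarrow> s \<le> t \<Longrightarrow> norm (h t - h s) \<le> K * (t - s)"
  shows "absolutely_continuous_on I h"
  unfolding absolutely_continuous_on_def
proof (intro allI impI)
  fix \<epsilon> :: real assume \<epsilon>: "\<epsilon> > 0"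
  define k where "k = max K 1"
  have k: "k > 0" by (simp add: k_def)
  show "\<exists>\<delta>>0. \<forall>(N::nat) c d. (\<forall>i<N. c i \<le> d i \<and> {c i..d i} \<subseteq> I) \<and>
        disjoint_family_on (\<lambda>i. {c i<..<d i}) {..<N} \<and> (\<Sum>i<N. d i - c i) < \<delta> \<longrightarrow>
        (\<Sum>i<N. norm (h (d i) - h (c i))) < \<epsilon>"
  proof (intro exI[of _ "\<epsilon> / k"] conjI allI impI)
    fix N :: nat and c d :: "nat \<Rightarrow> real"
    assume A: "(\<forall>i<N. c i \<le> d i \<and> {c i..d i} \<subseteq> I) \<and>
        disjoint_family_on (\<lambda>i. {c i<..<d i}) {..<N} \<and> (\<Sum>i<N. d i - c i) < \<epsilon> / k"
    have "(\<Sum>i<N. norm (h (d i) - h (c i))) \<le> (\<Sum>i<N. k * (d i - c i))"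
    proof (rule sum_mono)
      fix i assume "i \<in> {..<N}"
      then have cd: "c i \<le> d i" "{c i..d i} \<subseteq> I" using A by blast+
      then have i: "c i \<le> d i" "c i \<in> I" "d i \<in> I" by auto
      have "norm (h (d i) - h (c i)) \<le> K * (d i - c i)" using i by (intro assms) auto
      also have "\<dots> \<le> k * (d i - c i)" using i by (intro mult_right_mono) (auto simp: k_def)
      finally show "norm (h (d i) - h (c i)) \<le> k * (d i - c i)" .
    qed
    also have "\<dots> < k * (\<epsilon> / k)" unfolding sum_distrib_left[symmetric] using A k by (intro mult_strict_left_mono) auto
    finally show "(\<Sum>i<N. norm (h (d i) - h (c i))) < \<epsilon>" using k by simp
  qed (use \<epsilon> k in auto)
qed

text \<open>Extends a primitive on \<open>{a..b}\<close> to the line by constants, with density 0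
  outside, so that the differentiation theorem on the whole line applies.\<close>

lemma has_integral_clamp:
  fixes q :: "real \<Rightarrow> 'a::banach"
  assumes ab: "a \<le> b"
    and q: "\<And>s t. a \<le> s \<Longrightarrow> s \<le> t \<Longrightarrow> t \<le> b \<Longrightarrow> (q has_integral x t - x s) {s..t}"
    and cd: "c \<le> d"
  shows "((\<lambda>t. if t \<in> {a..b} then q t else 0) has_integral x (max a (min b d)) - x (max a (min b c))) {c..d}"
proof -
  have eq: "{a..b} \<inter> {c..d} = {max a c..min b d}" by auto
  have "(q has_integral x (max a (min b d)) - x (max a (min b c))) {max a c..min b d}"
  proof (cases "max a c \<le> min b d")
    case True
    then have "max a (min b d) = min b d" "max a (min b c) = max a c" using ab cd by auto
    then show ?thesis using q[of "max a c" "min b d"] True by auto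
  next
    case False
    then have "max a (min b d) = max a (min b c)" using ab cd by (auto simp: max_def min_def)
    then show ?thesis using False by simp
  qed
  then show ?thesis by (simp only: has_integral_restrict_Int eq)
qed

lemma AE_lebesgue_on_iff:
  "(AE t in lebesgue_on {a..b::real}. P t) \<longleftrightarrow> (AE t in lebesgue. t \<in> {a..b} \<longrightarrow> P t)"
  by (intro AE_restrict_space_iff) auto

lemma borel_measurable_lebesgue_on:
  fixes f :: "'a::euclidean_space \<Rightarrow> 'b::topological_space"
  assumes "f \<in> borel_measurable borel"
  shows "f \<in> borel_measurable (lebesgue_on S)"
  using assms by (intro measurable_restrict_space1 measurable_completion) simp

lemma norm_Pair_le_add: "norm (x, y) \<le> norm x + norm y"
  by (metis norm_Pair sqrt_sum_squares_le_sum norm_ge_zero)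

section \<open>The impulsive system and its uniform a priori bounds\<close>

text \<open>The two bounds play different roles. The total increment of \<open>h\<close> limits the
  variation and stays bounded along the approximating sequence; \<open>K\<close> only certifies that
  \<open>h\<close>, and hence \<open>w\<close>, is Lipschitz, and may blow up.\<close>

definition dominated_on :: "real set \<Rightarrow> (real \<Rightarrow> 'a::real_normed_vector) \<Rightarrow> (real \<Rightarrow> real) \<Rightarrow> real \<Rightarrow> bool" where
  "dominated_on I w h K \<longleftrightarrow>
     (\<forall>s\<in>I. \<forall>t\<in>I. s \<le> t \<longrightarrow> norm (w t - w s) \<le> h t - h s \<and> h t - h s \<le> K * (t - s))"

lemma dominated_onD:
  assumes "dominated_on I w h K" "s \<in> I" "t \<in> I" "s \<le> t"
  shows "norm (w t - w s) \<le> h t - h s" "h t - h s \<le> K * (t - s)"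
  using assms unfolding dominated_on_def by auto

text \<open>The input \<open>u\<close> is deliberately left out of the context: the bounds below
  have to be uniform over all approximating inputs.\<close>

locale impulsive_system =
  fixes a b :: real
    and U :: "(real^'m) set" and V :: "(real^'l) set"
    and f :: "real \<Rightarrow> real^'n \<Rightarrow> real^'m \<Rightarrow> real^'l \<Rightarrow> real^'n"
    and g :: "'m \<Rightarrow> real^'n \<Rightarrow> real^'n"
    and v :: "real \<Rightarrow> real^'l"
  assumes ab: "a \<le> b"
    and U_compact: "compact U"
    and V_compact: "compact V"
    and f_measurable:
      "\<And>x u v. v \<in> V \<Longrightarrow> (\<lambda>t. f t x u v) \<in> borel_measurable (lebesgue_on {a..b})"
    and f_continuous:
      "\<And>t. t \<in> {a..b} \<Longrightarrow> continuous_on (UNIV \<times> UNIV \<times> V) (\<lambda>(x, u, v). f t x u v)"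
    and f_lipschitz:
      "\<And>x0 u0. \<exists>r>0. \<exists>L. \<forall>t\<in>{a..b}. \<forall>v\<in>V. L-lipschitz_on (ball (x0, u0) r) (\<lambda>(x, u). f t x u v)"
    and g_C1: "\<And>\<alpha>. C1_map (g \<alpha>)"
    and growth:
      "\<exists>M>0. \<forall>t\<in>{a..b}. \<forall>v\<in>V. \<forall>x u. norm (f t x u v, \<chi> \<alpha>. g \<alpha> x) \<le> M * (1 + norm (x, u))"
    and v_L1: "v \<in> L1_reps {a..b} V"
begin

lemma V_nonempty:
  assumes "a < b"
  shows "V \<noteq> {}"
proof
  assume "V = {}"
  then have "AE t in lebesgue_on {a..b}. False" using v_L1 by (simp add: L1_reps_def)
  then have "AE t in lebesgue. t \<notin> {a..b}" by (simp only: AE_lebesgue_on_iff simp_thms)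
  then have "{a..b} \<in> null_sets lebesgue" by (subst AE_iff_null_sets) auto
  then have "emeasure lebesgue {a..b} = 0" by blast
  then show False using assms by simp
qed

text \<open>Membership in \<open>L1_reps\<close> places \<open>v\<close> in \<open>V\<close> only
  almost everywhere, while the assumptions on \<open>f\<close> concern parameters in
  \<open>V\<close>. A change on a null set repairs this without affecting the equation, which is
  itself required only almost everywhere. The default value exists by \<open>V_nonempty\<close>,
  hence \<open>a < b\<close>.\<close>

lemma modified_control:
  assumes "a < b"
  obtains v' where "v' \<in> borel_measurable (lebesgue_on {a..b})" "\<And>t. v' t \<in> V"
    "AE t in lebesgue_on {a..b}. v' t = v t"
proof -
  obtain v0 where v0: "v0 \<in> V" using V_nonempty[OF assms] by blast
  have [measurable]: "v \<in> borel_measurable (lebesgue_on {a..b})"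
    using v_L1 by (auto simp: L1_reps_def intro: absolutely_integrable_measurable[THEN iffD1, THEN conjunct1])
  have V[measurable]: "V \<in> sets borel" using V_compact by (simp add: compact_imp_closed borel_closed)
  show thesis
  proof (rule that[of "\<lambda>t. if v t \<in> V then v t else v0"])
    show "(\<lambda>t. if v t \<in> V then v t else v0) \<in> borel_measurable (lebesgue_on {a..b})"
      by measurable
    have "AE t in lebesgue_on {a..b}. v t \<in> V" using v_L1 by (simp add: L1_reps_def)
    then show "AE t in lebesgue_on {a..b}. (if v t \<in> V then v t else v0) = v t"
      by eventually_elim simp
  qed (use v0 in simp)
qed

text \<open>A one-point interval is null, so the differential equation is void there. The case is
  separate because \<open>V\<close> may then be empty and no modified control need exist.\<close>

lemma solution_at_point:
  assumes "a = b"
  shows "caratheodory_solution a b f g xbar u v (\<lambda>_. xbar)"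
proof -
  have "AE t in lebesgue_on {a..b}. P t" for P
    unfolding AE_lebesgue_on_iff
    by (rule AE_I'[of "{b}"]) (use assms in \<open>auto simp flip: negligible_iff_null_sets\<close>)
  then show ?thesis
    unfolding caratheodory_solution_def using \<open>a = b\<close>
    by (auto intro!: absolutely_continuous_on_lipschitz[of _ _ 0])
qed

text \<open>The radius \<open>R\<close> does not depend on the input, only on the bound \<open>C\<close> of its variation.
  Hence the right-hand side may be truncated outside the ball of radius \<open>R\<close>.\<close>

lemma solutions_uniformly_bounded:
  obtains R S where "\<And>u h K. u ` {a..b} \<subseteq> U \<Longrightarrow> dominated_on {a..b} u h K \<Longrightarrow> h b - h a \<le> C \<Longrightarrow>
    \<exists>x H. caratheodory_solution a b f g xbar u v x \<and> (\<forall>t\<in>{a..b}. norm (x t) \<le> R) \<and>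
      H b - H a \<le> S \<and> (\<forall>s t. a \<le> s \<longrightarrow> s \<le> t \<longrightarrow> t \<le> b \<longrightarrow> norm (x t - x s) \<le> H t - H s)"
proof (cases "a = b")
  case True
  have "\<exists>x H. caratheodory_solution a b f g xbar u v x \<and> (\<forall>t\<in>{a..b}. norm (x t) \<le> norm xbar) \<and>
      H b - H a \<le> (0::real) \<and> (\<forall>s t. a \<le> s \<longrightarrow> s \<le> t \<longrightarrow> t \<le> b \<longrightarrow> norm (x t - x s) \<le> H t - H s)" for u
    by (intro exI[of _ "\<lambda>_. xbar"] exI[of _ "\<lambda>_. 0"]) (auto intro!: solution_at_point True)
  then show thesis using that by blast
next
  case False
  then have ab': "a < b" using ab by simp
  obtain M where M: "M > 0"
    "\<And>t v x u. t \<in> {a..b} \<Longrightarrow> v \<in> V \<Longrightarrow> norm (f t x u v, \<chi> \<alpha>. g \<alpha> x) \<le> M * (1 + norm (x, u))"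
    using growth by blast
  obtain v' where v': "v' \<in> borel_measurable (lebesgue_on {a..b})" "\<And>t. v' t \<in> V"
    "AE t in lebesgue_on {a..b}. v' t = v t"
    using modified_control[OF ab'] by blast
  obtain \<rho> where \<rho>: "\<And>u. u \<in> U \<Longrightarrow> norm u \<le> \<rho>" "\<rho> > 0"
    using compact_imp_bounded[OF U_compact] unfolding bounded_pos by blast
  have f_bound: "norm (f t x u w) \<le> M * (1 + \<rho> + norm x)"
    if "t \<in> {a..b}" "w \<in> V" "u \<in> U" for t x u w
  proof -
    have "norm (f t x u w) \<le> M * (1 + norm (x, u))"
      using order_trans[OF norm_fst_le M(2)[OF that(1,2), of x u]] by simp
    also have "\<dots> \<le> M * (1 + \<rho> + norm x)"
      using M(1) \<rho>(1)[OF that(3)] norm_Pair_le_add[of x u] by (intro mult_left_mono) auto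
    finally show ?thesis .
  qed
  \<comment> \<open>Growth bounds the fields \<open>g\<close> only jointly with \<open>f\<close> at
    an admissible parameter, so some element of \<open>V\<close> is used, together with the time
    \<open>a\<close> and the input value 0.\<close>
  have g_bound: "norm (g \<alpha> x) \<le> M * (1 + \<rho> + norm x)" for \<alpha> x
  proof -
    obtain w where w: "w \<in> V" using v'(2) by blast
    have "norm (g \<alpha> x) = norm ((\<chi> \<alpha>. g \<alpha> x) $ \<alpha>)" by simp
    also have "\<dots> \<le> norm (\<chi> \<alpha>. g \<alpha> x)" by (rule Finite_Cartesian_Product.norm_nth_le)
    also have "\<dots> \<le> norm (f a x 0 w, \<chi> \<alpha>. g \<alpha> x)" by (rule norm_snd_le)
    also have "\<dots> \<le> M * (1 + norm (x, 0::real^'m))" using ab by (intro M(2)[OF _ w]) auto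
    also have "\<dots> \<le> M * (1 + \<rho> + norm x)"
      using M(1) \<rho>(2) norm_Pair_le_add[of x "0::real^'m"] by (intro mult_left_mono) auto
    finally show ?thesis .
  qed
  define m where "m = real CARD('m)"
  have m: "m \<ge> 0" by (simp add: m_def)
  \<comment> \<open>\<open>M * ((b - a) + m * C)\<close> will bound the total growth of
    \<open>H\<close>, and \<open>n\<close> counts the stretches of growth one half needed to cover
    it. Each stretch costs a factor 2, starting from \<open>1 + \<rho> + norm xbar\<close>, which
    explains \<open>R\<close> below; no Lipschitz constant of the input enters.\<close>
  define n where "n = nat \<lceil>2 * (M * ((b - a) + m * C))\<rceil>"
  have n: "M * ((b - a) + m * C) \<le> real n / 2" unfolding n_def by linarith
  define R where "R = 2 ^ n * (1 + \<rho> + norm xbar)"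
  have R: "R > 0" unfolding R_def using \<rho>(2) by (intro mult_pos_pos) (auto intro: add_pos_nonneg)
  \<comment> \<open>Projection onto the ball is 1-Lipschitz and fixes 0, so it does not increase
    norms: the truncated equation keeps the linear growth bound with the same constants, and the a
    priori estimate applies to its solution directly.\<close>
  define P where "P = closest_point (cball (0::real^'n) R)"
  have P_lip: "norm (P x - P y) \<le> norm (x - y)" for x y
    using closest_point_lipschitz[of "cball (0::real^'n) R" x y] R by (simp add: P_def dist_norm)
  have P_id: "norm x \<le> R \<Longrightarrow> P x = x" for x by (simp add: P_def closest_point_self)
  have P_le: "norm (P x) \<le> norm x" for x using P_lip[of x 0] P_id[of 0] R by simp
  have P_R: "P x \<in> cball 0 R" for x
    unfolding P_def using R by (intro closest_point_in_set) auto
  have P_cont: "continuous_on X P" for X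
    by (rule lipschitz_on_continuous_on[of 1]) (auto intro!: lipschitz_onI simp: dist_norm P_lip)
  obtain Kf where Kf: "Kf \<ge> 0" "\<And>t w x y u. t \<in> {a..b} \<Longrightarrow> w \<in> V \<Longrightarrow> x \<in> cball 0 R \<Longrightarrow> y \<in> cball 0 R \<Longrightarrow> u \<in> U \<Longrightarrow>
      norm (f t x u w - f t y u w) \<le> Kf * norm (x - y)"
  proof -
    obtain K where K: "K \<ge> 0" "\<And>i p q. i \<in> {a..b} \<times> V \<Longrightarrow> p \<in> cball 0 R \<times> U \<Longrightarrow> q \<in> cball 0 R \<times> U \<Longrightarrow>
       norm ((case i of (t, w) \<Rightarrow> \<lambda>(x, u). f t x u w) p - (case i of (t, w) \<Rightarrow> \<lambda>(x, u). f t x u w) q) \<le> K * dist p q"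
    proof (rule uniform_lipschitz_on_compact[of "cball (0::real^'n) R \<times> U" "{a..b} \<times> V"
          "\<lambda>i. case i of (t, w) \<Rightarrow> \<lambda>(x, u). f t x u w" "M * (1 + \<rho> + R)"])
      show "compact (cball (0::real^'n) R \<times> U)" using U_compact by (intro compact_Times) auto
      fix p :: "(real^'n) \<times> (real^'m)"
      show "\<exists>r>0. \<exists>L. \<forall>i\<in>{a..b} \<times> V. L-lipschitz_on (ball p r) (case i of (t, w) \<Rightarrow> \<lambda>(x, u). f t x u w)"
        using f_lipschitz[of "fst p" "snd p"] by simp
      fix i assume i: "i \<in> {a..b} \<times> V" and p: "p \<in> cball 0 R \<times> U"
      have "norm (f (fst i) (fst p) (snd p) (snd i)) \<le> M * (1 + \<rho> + norm (fst p))"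
        using i p by (intro f_bound) auto
      also have "\<dots> \<le> M * (1 + \<rho> + R)" using M(1) p by (intro mult_left_mono) auto
      finally show "norm ((case i of (t, w) \<Rightarrow> \<lambda>(x, u). f t x u w) p) \<le> M * (1 + \<rho> + R)"
        by (simp add: case_prod_unfold)
    qed blast
    have "norm (f t x u w - f t y u w) \<le> K * norm (x - y)"
      if "t \<in> {a..b}" "w \<in> V" "x \<in> cball 0 R" "y \<in> cball 0 R" "u \<in> U" for t w x y u
      using K(2)[of "(t, w)" "(x, u)" "(y, u)"] that by (simp add: dist_Pair_Pair dist_norm)
    then show thesis using that K(1) by blast
  qed
  have "\<exists>Kg\<ge>0. \<forall>x\<in>cball 0 R. \<forall>y\<in>cball 0 R. norm (g \<alpha> x - g \<alpha> y) \<le> Kg * norm (x - y)" for \<alpha>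
    by (rule C1_map_lipschitz[OF g_C1[of \<alpha>], of "cball 0 R"]) auto
  then obtain Kg where Kg: "\<And>\<alpha>. Kg \<alpha> \<ge> 0" "\<And>\<alpha> x y. x \<in> cball 0 R \<Longrightarrow> y \<in> cball 0 R \<Longrightarrow>
      norm (g \<alpha> x - g \<alpha> y) \<le> Kg \<alpha> * norm (x - y)"
    by metis
  have g_cont: "continuous_on X (g \<alpha>)" for X \<alpha>
    using g_C1[of \<alpha>] unfolding C1_map_def
    by (meson continuous_at_imp_continuous_on has_derivative_continuous)
  show thesis
  proof (rule that[of R "R * (M * ((b - a) + m * C))"])
    fix u h K assume u: "u ` {a..b} \<subseteq> U" and dom: "dominated_on {a..b} u h K" and C: "h b - h a \<le> C"
    define cl where "cl = (\<lambda>t. max a (min b t))"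
    have cl: "cl t \<in> {a..b}" "t \<in> {a..b} \<Longrightarrow> cl t = t" for t using ab by (auto simp: cl_def)
    have cl_mono: "s \<le> t \<Longrightarrow> cl s \<le> cl t" "s \<le> t \<Longrightarrow> cl t - cl s \<le> t - s" for s t by (auto simp: cl_def)
    have u_dom: "norm (u t - u s) \<le> h t - h s" "h t - h s \<le> K * (t - s)"
      if "s \<le> t" "s \<in> {a..b}" "t \<in> {a..b}" for s t
      using dominated_onD[OF dom that(2,3,1)] by auto
    have uU: "u (cl t) \<in> U" for t using u cl by auto
    have K: "K \<ge> 0"
    proof -
      have "0 \<le> K * (b - a)"
        using order_trans[OF order_trans[OF norm_ge_zero u_dom(1)] u_dom(2), of a b] ab by auto
      then show ?thesis using ab' by (simp add: zero_le_mult_iff)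
    qed
    have ucl: "norm (u (cl t) - u (cl s)) \<le> h (cl t) - h (cl s)"
      and hcl: "h (cl t) - h (cl s) \<le> K * (t - s)" if "s \<le> t" for s t
      using u_dom(1)[OF cl_mono(1)[OF that] cl(1) cl(1)] order_trans[OF u_dom(2)[OF cl_mono(1)[OF that] cl(1) cl(1)]
        mult_left_mono[OF cl_mono(2)[OF that] K]] by auto
    obtain du \<eta> where du: "du \<in> borel_measurable borel" "\<eta> \<in> borel_measurable borel"
      "\<And>t. norm (du t) \<le> \<eta> t" "\<And>t. \<eta> t \<le> K"
      "\<And>c d. c \<le> d \<Longrightarrow> (\<eta> has_integral h (cl d) - h (cl c)) {c..d}"
      "AE t in lebesgue. ((\<lambda>t. u (cl t)) has_vector_derivative du t) (at t)"
      using dominated_path_derivative[of "\<lambda>t. u (cl t)" "\<lambda>t. h (cl t)" K, OF ucl hcl] by blast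
    have \<eta>0: "0 \<le> \<eta> t" for t using order_trans[OF norm_ge_zero du(3)] .
    \<comment> \<open>The truncated right-hand side, with the corrected control \<open>v'\<close>
      and the everywhere bounded derivative \<open>du\<close>: globally Lipschitz and bounded in the
      state, as Picard iteration requires.\<close>
    define G where "G = (\<lambda>t x. f t (P x) (u (cl t)) (v' t) + (\<Sum>\<alpha>\<in>UNIV. du t $ \<alpha> *\<^sub>R g \<alpha> (P x)))"
    \<comment> \<open>\<open>\<beta>\<close> separates the time dependence from the factor
      \<open>1 + \<rho> + norm (P x)\<close>; the weight \<open>m\<close> comes from bounding each
      of the \<open>m\<close> components of \<open>du\<close> by \<open>\<eta>\<close>. Its
      primitive \<open>H\<close> below contains \<open>h\<close> but not \<open>K\<close>.\<close>
    define \<beta> where "\<beta> = (\<lambda>t. M * (1 + m * \<eta> t))"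
    have du_nth: "\<bar>du t $ \<alpha>\<bar> \<le> \<eta> t" for t \<alpha>
      using order_trans[OF Finite_Cartesian_Product.norm_nth_le[of "du t" \<alpha>] du(3)] by simp
    have G_growth: "norm (G t x) \<le> (1 + \<rho> + norm (P x)) * \<beta> t" if t: "t \<in> {a..b}" for t x
    proof -
      have "norm (G t x) \<le> norm (f t (P x) (u (cl t)) (v' t)) + (\<Sum>\<alpha>\<in>UNIV. norm (du t $ \<alpha> *\<^sub>R g \<alpha> (P x)))"
        unfolding G_def by (intro order_trans[OF norm_triangle_ineq] add_left_mono norm_sum)
      also have "\<dots> \<le> M * (1 + \<rho> + norm (P x)) + (\<Sum>\<alpha>\<in>(UNIV::'m set). \<eta> t * (M * (1 + \<rho> + norm (P x))))"
        using t v'(2) uU \<eta>0 du_nth g_bound by (intro add_mono f_bound sum_mono) (auto intro!: mult_mono)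
      also have "\<dots> = (1 + \<rho> + norm (P x)) * \<beta> t"
        by (simp add: \<beta>_def m_def algebra_simps)
      finally show ?thesis .
    qed
    have \<beta>0: "\<beta> t \<ge> 0" and \<beta>K: "\<beta> t \<le> M * (1 + m * K)" for t
      unfolding \<beta>_def using M(1) m \<eta>0[of t] du(4)[of t] by (auto intro!: mult_nonneg_nonneg mult_left_mono)
    define H where "H = (\<lambda>t. M * (t + m * h t))"
    have \<beta>_int: "(\<beta> has_integral H t - H s) {s..t}" if "a \<le> s" "s \<le> t" "t \<le> b" for s t
    proof -
      have "(\<eta> has_integral h t - h s) {s..t}" using du(5)[OF that(2)] cl(2)[of s] cl(2)[of t] that by simp
      then have "((\<lambda>t. M * (1 + m * \<eta> t)) has_integral M * ((t - s) + m * (h t - h s))) {s..t}"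
        using has_integral_const_real[of "1::real" s t] that(2)
        by (intro has_integral_mult_right has_integral_add) auto
      then show ?thesis by (simp add: \<beta>_def H_def algebra_simps)
    qed
    have H_mono: "H s \<le> H t" if "a \<le> s" "s \<le> t" "t \<le> b" for s t
      using has_integral_nonneg[OF \<beta>_int[OF that]] \<beta>0 by simp
    have H_lip: "H t - H s \<le> M * (1 + m * K) * (t - s)" if "a \<le> s" "s \<le> t" "t \<le> b" for s t
    proof -
      have "h t - h s \<le> K * (t - s)" using that by (intro u_dom) auto
      then have "M * ((t - s) + m * (h t - h s)) \<le> M * ((t - s) + m * (K * (t - s)))"
        using M(1) m by (intro mult_left_mono add_left_mono) auto
      then show ?thesis by (simp add: H_def algebra_simps)
    qed
    have H_total: "H b - H a \<le> M * ((b - a) + m * C)"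
    proof -
      have "H b - H a = M * ((b - a) + m * (h b - h a))" by (simp add: H_def algebra_simps)
      also have "\<dots> \<le> M * ((b - a) + m * C)"
        using M(1) m C by (intro mult_left_mono add_left_mono) auto
      finally show ?thesis .
    qed
    obtain x where x: "continuous_on {a..b} x" "x a = xbar"
      "\<And>s t. a \<le> s \<Longrightarrow> s \<le> t \<Longrightarrow> t \<le> b \<Longrightarrow> ((\<lambda>\<tau>. G \<tau> (x \<tau>)) has_integral x t - x s) {s..t}"
    proof (rule picard_integral_equation[of a b G "Kf + (\<Sum>\<alpha>\<in>UNIV. K * Kg \<alpha>)" "(1 + \<rho> + R) * (M * (1 + m * K))" xbar])
      fix y :: "real \<Rightarrow> real^'n" assume y: "continuous_on {a..b} y"
      have meas_cont: "k \<in> borel_measurable (lebesgue_on {a..b})" if "continuous_on {a..b} k" for k :: "real \<Rightarrow> 'z::topological_space"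
        using that by (intro continuous_imp_measurable_on_sets_lebesgue) auto
      have u_cont: "continuous_on {a..b} (\<lambda>t. u (cl t))"
      proof (rule lipschitz_on_continuous_on[OF lipschitz_on_leI])
        show "dist (u (cl s)) (u (cl t)) \<le> K * dist s t" if "s \<le> t" for s t
          using order_trans[OF ucl[OF that] hcl[OF that]] that by (simp add: dist_norm norm_minus_commute)
      qed (rule K)
      have Py: "continuous_on {a..b} (\<lambda>t. P (y t))" by (rule continuous_on_compose2[OF P_cont y]) auto
      have "(\<lambda>t. (case (P (y t), u (cl t), v' t) of (x, u, v) \<Rightarrow> f t x u v)) \<in> borel_measurable (lebesgue_on {a..b})"
      proof (rule caratheodory_measurable[where S = "UNIV \<times> UNIV \<times> V"])
        show "(\<lambda>t. (P (y t), u (cl t), v' t)) \<in> borel_measurable (lebesgue_on {a..b})"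
          by (intro borel_measurable_Pair meas_cont Py u_cont v')
      qed (use f_measurable f_continuous v'(2) in auto)
      moreover have "(\<lambda>t. \<Sum>\<alpha>\<in>UNIV. du t $ \<alpha> *\<^sub>R g \<alpha> (P (y t))) \<in> borel_measurable (lebesgue_on {a..b})"
      proof (intro borel_measurable_sum borel_measurable_scaleR)
        fix \<alpha>
        have "(\<lambda>t. du t \<bullet> axis \<alpha> 1) \<in> borel_measurable borel" using du(1) by simp
        then show "(\<lambda>t. du t $ \<alpha>) \<in> borel_measurable (lebesgue_on {a..b})"
          by (intro borel_measurable_lebesgue_on) (simp add: inner_axis)
        show "(\<lambda>t. g \<alpha> (P (y t))) \<in> borel_measurable (lebesgue_on {a..b})"
          by (intro meas_cont continuous_on_compose2[OF g_cont Py]) auto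
      qed
      ultimately show "(\<lambda>t. G t (y t)) \<in> borel_measurable (lebesgue_on {a..b})"
        unfolding G_def by simp
    next
      fix t x y assume t: "t \<in> {a..b}"
      have "norm (G t x - G t y) = norm ((f t (P x) (u (cl t)) (v' t) - f t (P y) (u (cl t)) (v' t)) +
          (\<Sum>\<alpha>\<in>UNIV. du t $ \<alpha> *\<^sub>R (g \<alpha> (P x) - g \<alpha> (P y))))"
        unfolding G_def by (simp add: sum_subtractf algebra_simps)
      also have "\<dots> \<le> Kf * norm (P x - P y) + (\<Sum>\<alpha>\<in>UNIV. norm (du t $ \<alpha> *\<^sub>R (g \<alpha> (P x) - g \<alpha> (P y))))"
        using t v'(2) uU P_R by (intro order_trans[OF norm_triangle_ineq] add_mono norm_sum Kf(2)) auto
      also have "\<dots> \<le> Kf * norm (P x - P y) + (\<Sum>\<alpha>\<in>UNIV. K * (Kg \<alpha> * norm (P x - P y)))"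
        using P_R K Kg order_trans[OF du_nth du(4)]
        by (intro add_left_mono sum_mono) (auto intro!: mult_mono)
      also have "\<dots> = (Kf + (\<Sum>\<alpha>\<in>UNIV. K * Kg \<alpha>)) * norm (P x - P y)"
        by (simp add: distrib_right sum_distrib_right mult.assoc)
      also have "\<dots> \<le> (Kf + (\<Sum>\<alpha>\<in>UNIV. K * Kg \<alpha>)) * norm (x - y)"
        using P_lip Kf(1) K Kg(1) by (intro mult_left_mono) (auto intro!: add_nonneg_nonneg sum_nonneg)
      finally show "norm (G t x - G t y) \<le> (Kf + (\<Sum>\<alpha>\<in>UNIV. K * Kg \<alpha>)) * norm (x - y)" .
    next
      fix t x assume t: "t \<in> {a..b}"
      have "norm (G t x) \<le> (1 + \<rho> + norm (P x)) * \<beta> t" by (rule G_growth[OF t])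
      also have "\<dots> \<le> (1 + \<rho> + R) * (M * (1 + m * K))"
        using P_R[of x] \<rho>(2) R \<beta>0 \<beta>K by (intro mult_mono) auto
      finally show "norm (G t x) \<le> (1 + \<rho> + R) * (M * (1 + m * K))" .
    qed (use ab in blast)+
    define w where "w = (\<lambda>t. 1 + \<rho> + norm (x t))"
    have diff_bound: "norm (x t - x s) \<le> k * (H t - H s)"
      if st: "a \<le> s" "s \<le> t" "t \<le> b" and k: "\<And>r. r \<in> {s..t} \<Longrightarrow> w r \<le> k" for s t k
    proof -
      have "norm (x t - x s) = norm (integral {s..t} (\<lambda>\<tau>. G \<tau> (x \<tau>)))"
        using integral_unique[OF x(3)[OF st]] by simp
      also have "\<dots> \<le> integral {s..t} (\<lambda>\<tau>. k * \<beta> \<tau>)"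
      proof (rule integral_norm_bound_integral)
        show "(\<lambda>\<tau>. G \<tau> (x \<tau>)) integrable_on {s..t}" using x(3)[OF st] by blast
        show "(\<lambda>\<tau>. k * \<beta> \<tau>) integrable_on {s..t}" using has_integral_mult_right[OF \<beta>_int[OF st], of k] by blast
        fix r assume r: "r \<in> {s..t}"
        have "norm (G r (x r)) \<le> (1 + \<rho> + norm (P (x r))) * \<beta> r" using r st by (intro G_growth) auto
        also have "\<dots> \<le> k * \<beta> r" using \<beta>0[of r] P_le[of "x r"] k[OF r] by (intro mult_right_mono) (auto simp: w_def)
        finally show "norm (G r (x r)) \<le> k * \<beta> r" .
      qed
      also have "\<dots> = k * (H t - H s)"
        using has_integral_mult_right[OF \<beta>_int[OF st], of k] by (rule integral_unique)
      finally show ?thesis .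
    qed
    \<comment> \<open>The doubling estimate bounds \<open>w\<close>, and hence the norm of
      \<open>x\<close>, by \<open>R\<close>. So the solution never leaves the ball on which
      \<open>P\<close> is the identity and solves the original equation.\<close>
    have w_le: "w t \<le> R" if t: "t \<in> {a..b}" for t
    proof -
      have "w t \<le> 2 ^ n * w a"
      proof (rule doubling_estimate[where H = H and a = a and b = b])
        show "continuous_on {a..b} w" unfolding w_def using x(1) by (intro continuous_intros)
        have "M * (1 + m * K) \<ge> 0" using M(1) m K by auto
        moreover have "dist (H s) (H t) \<le> M * (1 + m * K) * dist s t" if "s \<in> {a..b}" "t \<in> {a..b}" "s \<le> t" for s t
          using H_lip[of s t] H_mono[of s t] that by (simp add: dist_real_def)
        ultimately have "(M * (1 + m * K))-lipschitz_on {a..b} H"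
          by (intro lipschitz_on_leI) auto
        then show "continuous_on {a..b} H" by (rule lipschitz_on_continuous_on)
        show "w t \<le> w s + k * (H t - H s)" if "a \<le> s" "s \<le> t" "t \<le> b" "\<And>r. r \<in> {s..t} \<Longrightarrow> w r \<le> k" for s t k
          using diff_bound[OF that] norm_triangle_sub[of "x t" "x s"] by (simp add: w_def)
        show "H t - H a \<le> real n / 2" using H_total H_mono[of t b] n t by auto
      qed (use t H_mono \<rho>(2) in \<open>auto simp: w_def intro: add_nonneg_nonneg\<close>)
      then show ?thesis by (simp add: w_def R_def x(2))
    qed
    have x_le: "norm (x t) \<le> R" if "t \<in> {a..b}" for t using w_le[OF that] \<rho>(2) by (simp add: w_def)
    have x_H: "norm (x t - x s) \<le> R * (H t - H s)" if "a \<le> s" "s \<le> t" "t \<le> b" for s t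
      by (rule diff_bound[OF that]) (use that w_le in auto)
    have "caratheodory_solution a b f g xbar u v x"
      unfolding caratheodory_solution_def
    proof (intro conjI x(2))
      show "absolutely_continuous_on {a..b} x"
      proof (rule absolutely_continuous_on_lipschitz)
        fix s t assume st: "s \<in> {a..b}" "t \<in> {a..b}" "s \<le> t"
        then have "norm (x t - x s) \<le> R * (H t - H s)" by (intro x_H) auto
        also have "\<dots> \<le> R * (M * (1 + m * K) * (t - s))" using st R by (intro mult_left_mono H_lip) auto
        finally show "norm (x t - x s) \<le> R * (M * (1 + m * K)) * (t - s)" by (simp add: mult.assoc)
      qed
      have "AE t in lebesgue. ((\<lambda>t. x (cl t)) has_vector_derivative (if t \<in> {a..b} then G t (x t) else 0)) (at t)"
        by (rule lebesgue_differentiation_real) (unfold cl_def, rule has_integral_clamp[OF ab x(3)])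
      then have "AE t in lebesgue. t \<in> {a..b} \<longrightarrow> ((\<lambda>t. x (cl t)) has_vector_derivative G t (x t)) (at t) \<and>
          ((\<lambda>t. u (cl t)) has_vector_derivative du t) (at t)"
        using du(6) by eventually_elim auto
      then show "AE t in lebesgue_on {a..b}. \<exists>du. (u has_vector_derivative du) (at t within {a..b}) \<and>
          (x has_vector_derivative f t (x t) (u t) (v t) + (\<Sum>\<alpha>\<in>UNIV. du $ \<alpha> *\<^sub>R g \<alpha> (x t))) (at t within {a..b})"
        using v'(3) unfolding AE_lebesgue_on_iff
      proof eventually_elim
        case (elim t)
        show ?case
        proof (intro impI exI[of _ "du t"] conjI)
          assume t: "t \<in> {a..b}"
          show "(u has_vector_derivative du t) (at t within {a..b})"
            by (rule has_vector_derivative_transform[OF t, of u "\<lambda>t. u (cl t)"])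
              (use elim t cl in \<open>auto intro: has_vector_derivative_at_within\<close>)
          have "G t (x t) = f t (x t) (u t) (v t) + (\<Sum>\<alpha>\<in>UNIV. du t $ \<alpha> *\<^sub>R g \<alpha> (x t))"
            using elim t cl(2)[OF t] P_id[OF x_le[OF t]] by (simp add: G_def)
          then show "(x has_vector_derivative f t (x t) (u t) (v t) + (\<Sum>\<alpha>\<in>UNIV. du t $ \<alpha> *\<^sub>R g \<alpha> (x t))) (at t within {a..b})"
            by (intro has_vector_derivative_transform[OF t, of x "\<lambda>t. x (cl t)"])
              (use elim t cl in \<open>auto intro: has_vector_derivative_at_within\<close>)
        qed
      qed
    qed
    \<comment> \<open>Since \<open>w\<close> stays below \<open>R\<close>, increments of
      \<open>x\<close> are bounded by those of \<open>R * H\<close>; the total increment of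
      \<open>R * H\<close> is the uniform variation bound.\<close>
    moreover have "R * H b - R * H a \<le> R * (M * ((b - a) + m * C))"
      using mult_left_mono[OF H_total, of R] R by (simp add: right_diff_distrib)
    ultimately show "\<exists>x H. caratheodory_solution a b f g xbar u v x \<and> (\<forall>t\<in>{a..b}. norm (x t) \<le> R) \<and>
      H b - H a \<le> R * (M * ((b - a) + m * C)) \<and>
      (\<forall>s t. a \<le> s \<longrightarrow> s \<le> t \<longrightarrow> t \<le> b \<longrightarrow> norm (x t - x s) \<le> H t - H s)"
      using x_le x_H by (intro exI[of _ x] exI[of _ "\<lambda>t. R * H t"]) (auto simp: right_diff_distrib)
  qed
qed

end

section \<open>Total variation and approximation of the input\<close>

lemma total_variation_upper:
  assumes "mono_on {..N} t" "t ` {..N} \<subseteq> I"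
  shows "(\<Sum>i<N. ennreal (norm (h (t (Suc i)) - h (t i)))) \<le> total_variation I h"
  unfolding total_variation_def using assms by (intro Sup_upper) blast

lemma total_variation_least:
  assumes "\<And>N t. mono_on {..N} t \<Longrightarrow> t ` {..N} \<subseteq> I \<Longrightarrow>
    (\<Sum>i<N. ennreal (norm (h (t (Suc i)) - h (t i)))) \<le> C"
  shows "total_variation I h \<le> C"
  unfolding total_variation_def using assms by (intro Sup_least) blast

lemma total_variation_mono:
  assumes "I \<subseteq> J"
  shows "total_variation I h \<le> total_variation J h"
  by (intro total_variation_least total_variation_upper) (use assms in auto)

text \<open>Any partition of \<open>{a..s}\<close> can be prolonged by the points \<open>s\<close>
  and \<open>t\<close>. This half of additivity shows that increments of the variation function
  dominate those of \<open>h\<close>.\<close>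

lemma total_variation_add_jump:
  fixes h :: "real \<Rightarrow> 'a::real_normed_vector"
  assumes "a \<le> s" "s \<le> t"
  shows "total_variation {a..s} h + ennreal (norm (h t - h s)) \<le> total_variation {a..t} h"
proof -
  let ?c = "ennreal (norm (h t - h s))"
  have step: "(\<Sum>i<N. ennreal (norm (h (\<tau> (Suc i)) - h (\<tau> i)))) + ?c \<le> total_variation {a..t} h"
    if \<tau>: "mono_on {..N} \<tau>" "\<tau> ` {..N} \<subseteq> {a..s}" for N and \<tau> :: "nat \<Rightarrow> real"
  proof -
    \<comment> \<open>The partition may end before \<open>s\<close>, so two points are appended; the
      piece from its last point to \<open>s\<close> is afterwards dropped as nonnegative.\<close>
    define \<sigma> where "\<sigma> = (\<lambda>i. if i \<le> N then \<tau> i else if i = Suc N then s else t)"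
    have \<tau>_le: "a \<le> \<tau> i" "\<tau> i \<le> s" if "i \<le> N" for i using \<tau>(2) that by auto
    have "mono_on {..Suc (Suc N)} \<sigma>"
    proof (rule mono_onI)
      fix i j assume "i \<in> {..Suc (Suc N)}" "j \<in> {..Suc (Suc N)}" "i \<le> j"
      then show "\<sigma> i \<le> \<sigma> j"
        using mono_onD[OF \<tau>(1), of i j] \<tau>_le[of i] assms by (auto simp: \<sigma>_def)
    qed
    moreover have "\<sigma> ` {..Suc (Suc N)} \<subseteq> {a..t}"
      using \<tau>_le assms by (auto simp: \<sigma>_def image_subset_iff) (meson order_trans)
    ultimately have "(\<Sum>i<Suc (Suc N). ennreal (norm (h (\<sigma> (Suc i)) - h (\<sigma> i)))) \<le> total_variation {a..t} h"
      by (rule total_variation_upper)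
    moreover have "(\<Sum>i<N. ennreal (norm (h (\<sigma> (Suc i)) - h (\<sigma> i)))) = (\<Sum>i<N. ennreal (norm (h (\<tau> (Suc i)) - h (\<tau> i))))"
      by (intro sum.cong) (auto simp: \<sigma>_def)
    moreover have "ennreal (norm (h (\<sigma> (Suc (Suc N))) - h (\<sigma> (Suc N)))) = ?c"
      by (simp add: \<sigma>_def)
    ultimately have "(\<Sum>i<N. ennreal (norm (h (\<tau> (Suc i)) - h (\<tau> i)))) +
        ennreal (norm (h (\<sigma> (Suc N)) - h (\<sigma> N))) + ?c \<le> total_variation {a..t} h"
      by (simp only: sum.lessThan_Suc)
    then show ?thesis
      by (rule order_trans[rotated]) (intro add_right_mono add_increasing2 order_refl, simp)
  qed
  show ?thesis
  proof (cases "total_variation {a..t} h = \<infinity>")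
    case False
    have le: "?c \<le> total_variation {a..t} h"
      using step[of 0 "\<lambda>_. a"] assms by (auto simp: mono_on_def)
    have "total_variation {a..s} h \<le> total_variation {a..t} h - ?c"
    proof (rule total_variation_least)
      fix N and \<tau> :: "nat \<Rightarrow> real" assume "mono_on {..N} \<tau>" "\<tau> ` {..N} \<subseteq> {a..s}"
      then have "(\<Sum>i<N. ennreal (norm (h (\<tau> (Suc i)) - h (\<tau> i)))) + ?c - ?c \<le> total_variation {a..t} h - ?c"
        by (intro ennreal_minus_mono step order_refl)
      then show "(\<Sum>i<N. ennreal (norm (h (\<tau> (Suc i)) - h (\<tau> i)))) \<le> total_variation {a..t} h - ?c"
        by simp
    qed
    then have "total_variation {a..s} h + ?c \<le> total_variation {a..t} h - ?c + ?c"
      by (rule add_right_mono)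
    also have "\<dots> = total_variation {a..t} h" using le by (rule diff_add_cancel_ennreal)
    finally show ?thesis .
  qed simp
qed

text \<open>Instead of inserting \<open>s\<close> into a partition, its points are clamped to either
  side of \<open>s\<close>. As \<open>h (min r s) + h (max r s)\<close> equals
  \<open>h r + h s\<close>, each increment is exactly the sum of the two clamped increments.\<close>

lemma total_variation_split:
  fixes h :: "real \<Rightarrow> 'a::real_normed_vector"
  assumes st: "a \<le> s" "s \<le> t"
  shows "total_variation {a..t} h \<le> total_variation {a..s} h + total_variation {s..t} h"
proof (rule total_variation_least)
  fix N and \<tau> :: "nat \<Rightarrow> real" assume \<tau>: "mono_on {..N} \<tau>" "\<tau> ` {..N} \<subseteq> {a..t}"
  have "(\<Sum>i<N. ennreal (norm (h (\<tau> (Suc i)) - h (\<tau> i)))) \<le>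
     (\<Sum>i<N. ennreal (norm (h (min (\<tau> (Suc i)) s) - h (min (\<tau> i) s))) +
        ennreal (norm (h (max (\<tau> (Suc i)) s) - h (max (\<tau> i) s))))"
  proof (rule sum_mono)
    fix i
    have "h (\<tau> (Suc i)) - h (\<tau> i) = (h (min (\<tau> (Suc i)) s) - h (min (\<tau> i) s)) + (h (max (\<tau> (Suc i)) s) - h (max (\<tau> i) s))"
      by (auto simp: min_def max_def)
    then have "norm (h (\<tau> (Suc i)) - h (\<tau> i)) \<le> norm (h (min (\<tau> (Suc i)) s) - h (min (\<tau> i) s)) +
        norm (h (max (\<tau> (Suc i)) s) - h (max (\<tau> i) s))"
      by (metis norm_triangle_ineq)
    then show "ennreal (norm (h (\<tau> (Suc i)) - h (\<tau> i))) \<le> ennreal (norm (h (min (\<tau> (Suc i)) s) - h (min (\<tau> i) s))) +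
        ennreal (norm (h (max (\<tau> (Suc i)) s) - h (max (\<tau> i) s)))"
      by (subst ennreal_plus[symmetric]) (simp_all only: norm_ge_zero ennreal_leI)
  qed
  also have "\<dots> \<le> total_variation {a..s} h + total_variation {s..t} h"
    unfolding sum.distrib
  proof (intro add_mono)
    have \<tau>_mono: "\<tau> i \<le> \<tau> j" if "i \<in> {..N}" "j \<in> {..N}" "i \<le> j" for i j
      using mono_onD[OF \<tau>(1) that] .
    show "(\<Sum>i<N. ennreal (norm (h (min (\<tau> (Suc i)) s) - h (min (\<tau> i) s)))) \<le> total_variation {a..s} h"
      by (rule total_variation_upper[of N "\<lambda>i. min (\<tau> i) s"])
        (use \<tau>(2) st \<tau>_mono in \<open>auto simp: image_subset_iff intro!: mono_onI min.mono\<close>)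
    show "(\<Sum>i<N. ennreal (norm (h (max (\<tau> (Suc i)) s) - h (max (\<tau> i) s)))) \<le> total_variation {s..t} h"
      by (rule total_variation_upper[of N "\<lambda>i. max (\<tau> i) s"])
        (use \<tau>(2) st \<tau>_mono in \<open>auto simp: image_subset_iff intro!: mono_onI max.mono\<close>)
  qed
  finally show "(\<Sum>i<N. ennreal (norm (h (\<tau> (Suc i)) - h (\<tau> i)))) \<le> total_variation {a..s} h + total_variation {s..t} h" .
qed

lemma total_variation_dominated:
  fixes h :: "real \<Rightarrow> 'a::real_normed_vector"
  assumes ab: "a \<le> b" and dom: "\<And>s t. a \<le> s \<Longrightarrow> s \<le> t \<Longrightarrow> t \<le> b \<Longrightarrow> norm (h t - h s) \<le> H t - H s"
  shows "total_variation {a..b} h \<le> ennreal (H b - H a)"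
proof (rule total_variation_least)
  fix N and \<tau> :: "nat \<Rightarrow> real" assume \<tau>: "mono_on {..N} \<tau>" "\<tau> ` {..N} \<subseteq> {a..b}"
  have H_mono: "H s \<le> H t" if "a \<le> s" "s \<le> t" "t \<le> b" for s t
    using order_trans[OF norm_ge_zero dom[OF that]] by simp
  have "(\<Sum>i<N. norm (h (\<tau> (Suc i)) - h (\<tau> i))) \<le> (\<Sum>i<N. H (\<tau> (Suc i)) - H (\<tau> i))"
    using \<tau> by (intro sum_mono dom) (auto simp: mono_on_def image_subset_iff)
  also have "\<dots> = H (\<tau> N) - H (\<tau> 0)" by (rule sum_lessThan_telescope)
  also have "\<dots> \<le> H b - H a"
    using \<tau>(2) ab H_mono[of "\<tau> N" b] H_mono[of a "\<tau> 0"] by (auto simp: image_subset_iff intro!: diff_mono)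
  finally have "(\<Sum>i<N. norm (h (\<tau> (Suc i)) - h (\<tau> i))) \<le> H b - H a" .
  then show "(\<Sum>i<N. ennreal (norm (h (\<tau> (Suc i)) - h (\<tau> i)))) \<le> ennreal (H b - H a)"
    by (simp only: sum_ennreal norm_ge_zero ennreal_leI)
qed

text \<open>The cells of any partition of a short interval form a disjoint family admissible in the
  definition, so one \<open>\<delta>\<close> bounds all partition sums at once.\<close>

lemma absolutely_continuous_on_small_variation:
  fixes h :: "real \<Rightarrow> 'a::real_normed_vector"
  assumes "absolutely_continuous_on I h" "\<epsilon> > 0"
  obtains \<delta> where "\<delta> > 0"
    "\<And>s t. s \<le> t \<Longrightarrow> {s..t} \<subseteq> I \<Longrightarrow> t - s < \<delta> \<Longrightarrow> total_variation {s..t} h \<le> ennreal \<epsilon>"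
proof -
  obtain \<delta> where \<delta>: "\<delta> > 0 \<and> (\<forall>(N::nat) c d. (\<forall>i<N. c i \<le> d i \<and> {c i..d i} \<subseteq> I) \<and>
        disjoint_family_on (\<lambda>i. {c i<..<d i}) {..<N} \<and> (\<Sum>i<N. d i - c i) < \<delta> \<longrightarrow>
        (\<Sum>i<N. norm (h (d i) - h (c i))) < \<epsilon>)"
    using assms(1)[unfolded absolutely_continuous_on_def, THEN spec, THEN mp, OF assms(2)] by (rule exE)
  show thesis
  proof (rule that[OF \<delta>[THEN conjunct1]], rule total_variation_least)
    fix s t :: real and N and \<tau> :: "nat \<Rightarrow> real"
    assume st: "s \<le> t" "{s..t} \<subseteq> I" "t - s < \<delta>" and \<tau>: "mono_on {..N} \<tau>" "\<tau> ` {..N} \<subseteq> {s..t}"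
    have \<tau>_mono: "\<tau> i \<le> \<tau> j" if "i \<le> j" "j \<le> N" for i j
      using mono_onD[OF \<tau>(1), of i j] that by auto
    have \<tau>_in: "s \<le> \<tau> i" "\<tau> i \<le> t" if "i \<le> N" for i using \<tau>(2) that by auto
    have "(\<Sum>i<N. norm (h (\<tau> (Suc i)) - h (\<tau> i))) < \<epsilon>"
    proof (rule \<delta>[THEN conjunct2, THEN spec, THEN spec, THEN spec, THEN mp], intro conjI)
      show "\<forall>i<N. \<tau> i \<le> \<tau> (Suc i) \<and> {\<tau> i..\<tau> (Suc i)} \<subseteq> I"
      proof (intro allI impI conjI)
        fix i assume i: "i < N"
        show "\<tau> i \<le> \<tau> (Suc i)" using i by (intro \<tau>_mono) auto
        have "s \<le> \<tau> i" "\<tau> (Suc i) \<le> t" using i \<tau>_in by auto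
        then show "{\<tau> i..\<tau> (Suc i)} \<subseteq> I" using st(2) by (auto simp: subset_iff)
      qed
      have "{\<tau> i<..<\<tau> (Suc i)} \<inter> {\<tau> j<..<\<tau> (Suc j)} = {}" if "i < j" "j < N" for i j
        using \<tau>_mono[of "Suc i" j] that by auto
      then have "{\<tau> i<..<\<tau> (Suc i)} \<inter> {\<tau> j<..<\<tau> (Suc j)} = {}" if "i \<noteq> j" "i < N" "j < N" for i j
        using that by (metis Int_commute nat_neq_iff)
      then show "disjoint_family_on (\<lambda>i. {\<tau> i<..<\<tau> (Suc i)}) {..<N}"
        unfolding disjoint_family_on_def by auto
      have "(\<Sum>i<N. \<tau> (Suc i) - \<tau> i) = \<tau> N - \<tau> 0" by (rule sum_lessThan_telescope)
      also have "\<dots> \<le> t - s" using \<tau>_in[of N] \<tau>_in[of 0] by auto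
      finally show "(\<Sum>i<N. \<tau> (Suc i) - \<tau> i) < \<delta>" using st(3) by simp
    qed
    then show "(\<Sum>i<N. ennreal (norm (h (\<tau> (Suc i)) - h (\<tau> i)))) \<le> ennreal \<epsilon>"
      by (simp only: sum_ennreal norm_ge_zero ennreal_leI less_imp_le)
  qed
qed

lemma absolutely_continuous_on_imp_continuous_on:
  fixes h :: "real \<Rightarrow> 'a::real_normed_vector"
  assumes "absolutely_continuous_on {a..b} h"
  shows "continuous_on {a..b} h"
  unfolding continuous_on_iff
proof (intro ballI allI impI)
  fix s e :: real assume s: "s \<in> {a..b}" and e: "e > 0"
  obtain \<delta> where \<delta>: "\<delta> > 0" "\<And>s t. s \<le> t \<Longrightarrow> {s..t} \<subseteq> {a..b} \<Longrightarrow> t - s < \<delta> \<Longrightarrow>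
      total_variation {s..t} h \<le> ennreal (e / 2)"
    using absolutely_continuous_on_small_variation[OF assms, of "e / 2"] e by auto
  have le: "norm (h t - h r) \<le> e / 2" if "r \<in> {a..b}" "t \<in> {a..b}" "r \<le> t" "t - r < \<delta>" for r t
  proof -
    have "total_variation {r..r} h + ennreal (norm (h t - h r)) \<le> total_variation {r..t} h"
      using that by (intro total_variation_add_jump) auto
    also have "\<dots> \<le> ennreal (e / 2)" using that by (intro \<delta>(2)) auto
    finally have "ennreal (norm (h t - h r)) \<le> ennreal (e / 2)"
      by (rule order_trans[rotated]) simp
    then show ?thesis using e by (simp add: ennreal_le_iff)
  qed
  have "dist (h t) (h s) < e" if t: "t \<in> {a..b}" "dist t s < \<delta>" for t
    using le[of s t] le[of t s] s t e by (cases "s \<le> t") (auto simp: dist_norm norm_minus_commute)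
  then show "\<exists>d>0. \<forall>t\<in>{a..b}. dist t s < d \<longrightarrow> dist (h t) (h s) < e" using \<delta>(1) by blast
qed

lemma variation_function_dominates:
  fixes h :: "real \<Rightarrow> 'a::real_normed_vector"
  assumes fin: "total_variation {a..b} h < \<infinity>" and st: "a \<le> s" "s \<le> t" "t \<le> b"
  shows "norm (h t - h s) \<le> enn2real (total_variation {a..t} h) - enn2real (total_variation {a..s} h)"
proof -
  have fin': "total_variation {a..r} h < \<infinity>" if "r \<le> b" for r
    using total_variation_mono[of "{a..r}" "{a..b}" h] that fin by (auto intro: le_less_trans)
  have "enn2real (total_variation {a..s} h + ennreal (norm (h t - h s))) \<le> enn2real (total_variation {a..t} h)"
    using fin'[of t] st by (intro enn2real_mono total_variation_add_jump) auto
  then show ?thesis using fin'[of s] st by (simp add: enn2real_plus)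
qed

text \<open>Arc-length parametrization: \<open>\<gamma>2 (V s / V 1) = \<gamma> s\<close>, where \<open>V\<close> is the variation function
  of \<open>\<gamma>\<close>.\<close>

lemma absolutely_continuous_path_reparametrization:
  fixes \<gamma> :: "real \<Rightarrow> 'a::real_normed_vector"
  assumes \<gamma>: "\<gamma> \<in> AC {0..1} E" and K: "total_variation {0..1} \<gamma> \<le> ennreal K" "0 \<le> K"
  obtains \<gamma>2 where "\<gamma>2 ` {0..1} \<subseteq> E" "\<gamma>2 0 = \<gamma> 0" "\<gamma>2 1 = \<gamma> 1"
    "\<And>s t. s \<in> {0..1} \<Longrightarrow> t \<in> {0..1} \<Longrightarrow> norm (\<gamma>2 t - \<gamma>2 s) \<le> K * \<bar>t - s\<bar>"
proof -
  define V where "V = (\<lambda>s. enn2real (total_variation {0..s} \<gamma>))"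
  have fin1: "total_variation {0..1} \<gamma> < \<infinity>" using K by (auto intro: le_less_trans)
  have fin: "total_variation {0..s} \<gamma> < \<infinity>" if "s \<le> 1" for s
    using total_variation_mono[of "{0..s}" "{0..1}" \<gamma>] that fin1 by (auto intro: le_less_trans)
  have dom: "norm (\<gamma> t - \<gamma> s) \<le> V t - V s" if "0 \<le> s" "s \<le> t" "t \<le> 1" for s t
    unfolding V_def using variation_function_dominates[OF fin1 that] .
  have dom': "norm (\<gamma> t - \<gamma> s) \<le> \<bar>V t - V s\<bar>" if "s \<in> {0..1}" "t \<in> {0..1}" for s t
    using dom[of s t] dom[of t s] that by (cases "s \<le> t") (auto simp: norm_minus_commute)
  have V0: "V 0 = 0"
  proof -
    have "total_variation {0..0} \<gamma> \<le> ennreal (0 - 0)"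
    proof (rule total_variation_dominated[of 0 0 \<gamma> "\<lambda>_. 0"])
      fix s t :: real assume "0 \<le> s" "s \<le> t" "t \<le> 0"
      then have "s = t" by linarith
      then show "norm (\<gamma> t - \<gamma> s) \<le> 0 - 0" by simp
    qed simp
    then show ?thesis by (simp add: V_def)
  qed
  \<comment> \<open>Splitting bounds the increment of \<open>V\<close> by the variation over
    \<open>{s..t}\<close>, which absolute continuity makes small. Continuity of \<open>V\<close> is
    needed to reach every intermediate arc length.\<close>
  have "uniformly_continuous_on {0..1} V"
    unfolding uniformly_continuous_on_def
  proof (intro allI impI)
    fix e :: real assume "e > 0"
    then obtain \<delta> where \<delta>: "\<delta> > 0" "\<And>s t. s \<le> t \<Longrightarrow> {s..t} \<subseteq> {0..1} \<Longrightarrow> t - s < \<delta> \<Longrightarrow>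
        total_variation {s..t} \<gamma> \<le> ennreal (e / 2)"
      using absolutely_continuous_on_small_variation[of "{0..1}" \<gamma> "e / 2"] \<gamma> by (auto simp: AC_def)
    have small: "\<bar>V t - V s\<bar> < e" if st: "0 \<le> s" "s \<le> t" "t \<le> 1" "t - s < \<delta>" for s t
    proof -
      have tv: "total_variation {s..t} \<gamma> \<le> ennreal (e / 2)" using st by (intro \<delta>(2)) auto
      have "total_variation {0..t} \<gamma> \<le> total_variation {0..s} \<gamma> + total_variation {s..t} \<gamma>"
        using st by (intro total_variation_split) auto
      also have "\<dots> \<le> total_variation {0..s} \<gamma> + ennreal (e / 2)" using tv by (rule add_left_mono)
      finally have "V t \<le> enn2real (total_variation {0..s} \<gamma> + ennreal (e / 2))"
        unfolding V_def using fin[of s] st by (intro enn2real_mono) auto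
      then have "V t \<le> V s + e / 2" using fin[of s] st \<open>e > 0\<close> by (simp add: V_def enn2real_plus)
      moreover have "V s \<le> V t" using order_trans[OF norm_ge_zero dom[of s t]] st by simp
      ultimately show ?thesis using \<open>e > 0\<close> by simp
    qed
    have "\<bar>V t - V s\<bar> < e" if "s \<in> {0..1}" "t \<in> {0..1}" "\<bar>t - s\<bar> < \<delta>" for s t
      using small[of s t] small[of t s] that by (cases "s \<le> t") (auto simp: abs_minus_commute)
    then show "\<exists>d>0. \<forall>x\<in>{0..1}. \<forall>x'\<in>{0..1}. dist x' x < d \<longrightarrow> dist (V x') (V x) < e"
      using \<delta>(1) by (auto simp: dist_real_def)
  qed
  then have "continuous_on {0..1} V" by (rule uniformly_continuous_imp_continuous)
  have V1: "0 \<le> V 1" "V 1 \<le> K"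
    using K enn2real_mono[OF K(1)] by (auto simp: V_def)
  have "\<exists>s\<in>{0..1}. V s = r * V 1" if "r \<in> {0..1}" for r
    using IVT'[of V 0 "r * V 1" 1] V0 V1 that \<open>continuous_on {0..1} V\<close> by (auto simp: mult_left_le_one_le)
  \<comment> \<open>\<open>V\<close> may have flat stretches, so \<open>\<sigma>\<close> merely
    selects some time with the given arc length. The selection is immaterial: equal values of
    \<open>V\<close> force equal values of \<open>\<gamma>\<close>. The degenerate case
    \<open>V 1 = 0\<close> needs no special treatment.\<close>
  then obtain \<sigma> where \<sigma>: "\<And>r. r \<in> {0..1} \<Longrightarrow> \<sigma> r \<in> {0..1}" "\<And>r. r \<in> {0..1} \<Longrightarrow> V (\<sigma> r) = r * V 1"
    by metis
  show thesis
  proof (rule that[of "\<lambda>r. \<gamma> (\<sigma> r)"])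
    show "(\<lambda>r. \<gamma> (\<sigma> r)) ` {0..1} \<subseteq> E" using \<gamma> \<sigma>(1) by (auto simp: AC_def)
    show "\<gamma> (\<sigma> 0) = \<gamma> 0" using dom'[of 0 "\<sigma> 0"] \<sigma>[of 0] V0 by simp
    show "\<gamma> (\<sigma> 1) = \<gamma> 1" using dom'[of 1 "\<sigma> 1"] \<sigma>[of 1] by simp
    fix s t :: real assume st: "s \<in> {0..1}" "t \<in> {0..1}"
    have "norm (\<gamma> (\<sigma> t) - \<gamma> (\<sigma> s)) \<le> \<bar>t * V 1 - s * V 1\<bar>"
      using dom'[OF \<sigma>(1)[OF st(1)] \<sigma>(1)[OF st(2)]] \<sigma>(2)[OF st(1)] \<sigma>(2)[OF st(2)] by simp
    also have "\<dots> = V 1 * \<bar>t - s\<bar>" using V1 by (simp add: abs_mult flip: left_diff_distrib)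
    also have "\<dots> \<le> K * \<bar>t - s\<bar>" using V1 by (intro mult_right_mono) auto
    finally show "norm (\<gamma> (\<sigma> t) - \<gamma> (\<sigma> s)) \<le> K * \<bar>t - s\<bar>" .
  qed
qed

section \<open>Lipschitz interpolation of the input at finitely many points\<close>

lemma dominated_on_glue:
  assumes 1: "dominated_on {a..p} w1 h1 K1" and 2: "dominated_on {p..b} w2 h2 K2"
    and w: "w1 p = w2 p" and h: "h1 p = h2 p" and p: "a \<le> p" "p \<le> b"
  shows "dominated_on {a..b} (\<lambda>t. if t \<le> p then w1 t else w2 t) (\<lambda>t. if t \<le> p then h1 t else h2 t) (max K1 K2)"
  unfolding dominated_on_def
proof (intro ballI impI)
  fix s t assume st: "s \<in> {a..b}" "t \<in> {a..b}" "s \<le> t"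
  have K: "K1 * r \<le> max K1 K2 * r" "K2 * r \<le> max K1 K2 * r" if "r \<ge> 0" for r
    using that by (auto intro: mult_right_mono)
  consider "t \<le> p" | "p < s" | "s \<le> p" "p < t" by linarith
  then show "norm ((if t \<le> p then w1 t else w2 t) - (if s \<le> p then w1 s else w2 s)) \<le>
      (if t \<le> p then h1 t else h2 t) - (if s \<le> p then h1 s else h2 s) \<and>
      (if t \<le> p then h1 t else h2 t) - (if s \<le> p then h1 s else h2 s) \<le> max K1 K2 * (t - s)"
  proof cases
    case 1
    then show ?thesis using dominated_onD[OF assms(1), of s t] K(1)[of "t - s"] st by auto
  next
    case 2
    then show ?thesis using dominated_onD[OF assms(2), of s t] K(2)[of "t - s"] st by auto
  next
    case 3
    have A: "norm (w1 p - w1 s) \<le> h1 p - h1 s" "h1 p - h1 s \<le> max K1 K2 * (p - s)"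
      using dominated_onD[OF assms(1), of s p] order_trans[OF _ K(1)[of "p - s"]] 3 st by auto
    have B: "norm (w2 t - w2 p) \<le> h2 t - h2 p" "h2 t - h2 p \<le> max K1 K2 * (t - p)"
      using dominated_onD[OF assms(2), of p t] order_trans[OF _ K(2)[of "t - p"]] 3 st by auto
    have "norm (w2 t - w1 s) \<le> norm (w2 t - w2 p) + norm (w1 p - w1 s)"
      using norm_triangle_ineq[of "w2 t - w2 p" "w1 p - w1 s"] w by simp
    moreover have "max K1 K2 * (t - s) = max K1 K2 * (t - p) + max K1 K2 * (p - s)"
      by (simp add: algebra_simps)
    ultimately show ?thesis using A B h 3 by simp
  qed
qed

text \<open>Induction adds the new largest point, so each step glues one path at the right end.
  Because \<open>h\<close> equals \<open>M * W\<close> exactly at the nodes, its total increment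
  depends only on the extreme nodes and not on their number; \<open>K\<close> grows as nodes get
  close.\<close>

lemma finite_set_interpolation:
  fixes u :: "real \<Rightarrow> 'a::real_normed_vector"
  assumes paths: "\<And>u1 u2. u1 \<in> U \<Longrightarrow> u2 \<in> U \<Longrightarrow> \<exists>\<gamma>. \<gamma> ` {0..1} \<subseteq> U \<and> \<gamma> 0 = u1 \<and> \<gamma> 1 = u2 \<and>
      (\<forall>s\<in>{0..1}. \<forall>t\<in>{0..1}. norm (\<gamma> t - \<gamma> s) \<le> M * norm (u1 - u2) * \<bar>t - s\<bar>)"
    and M: "M \<ge> 0" and P: "finite P"
  shows "P \<noteq> {} \<Longrightarrow> u ` P \<subseteq> U \<Longrightarrow> (\<And>s t. s \<in> P \<Longrightarrow> t \<in> P \<Longrightarrow> s \<le> t \<Longrightarrow> norm (u t - u s) \<le> W t - W s) \<Longrightarrow>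
    \<exists>w h K. w ` {Min P..Max P} \<subseteq> U \<and> dominated_on {Min P..Max P} w h K \<and> (\<forall>p\<in>P. w p = u p \<and> h p = M * W p)"
  using P
proof (induction P rule: finite_linorder_max_induct)
  case empty
  then show ?case by simp
next
  case (insert b A)
  show ?case
  proof (cases "A = {}")
    case True
    have "dominated_on {b..b} (\<lambda>_. u b) (\<lambda>_. M * W b) 0" by (simp add: dominated_on_def)
    then show ?thesis using True insert.prems
      by (intro exI[of _ "\<lambda>_. u b"] exI[of _ "\<lambda>_. M * W b"] exI[of _ 0]) auto
  next
    case False
    define p where "p = Max A"
    define a where "a = Min A"
    have pA: "p \<in> A" and A_p: "\<And>x. x \<in> A \<Longrightarrow> x \<le> p" and aA: "a \<in> A" and a_A: "\<And>x. x \<in> A \<Longrightarrow> a \<le> x"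
      using insert.hyps(1) False by (auto simp: p_def a_def)
    have pb: "p < b" using pA insert.hyps(2) by blast
    have ap: "a \<le> p" using aA A_p by blast
    have MinMax: "Min (insert b A) = a" "Max (insert b A) = b"
      using insert.hyps(1) False ap pb by (auto simp: p_def[symmetric] a_def[symmetric])
    obtain w1 h1 K1 where 1: "w1 ` {a..p} \<subseteq> U" "dominated_on {a..p} w1 h1 K1"
      "\<And>q. q \<in> A \<Longrightarrow> w1 q = u q" "\<And>q. q \<in> A \<Longrightarrow> h1 q = M * W q"
      using insert.IH[OF False] insert.prems unfolding p_def[symmetric] a_def[symmetric] by auto
    obtain \<gamma> where \<gamma>: "\<gamma> ` {0..1} \<subseteq> U" "\<gamma> 0 = u p" "\<gamma> 1 = u b"
      "\<And>s t. s \<in> {0..1} \<Longrightarrow> t \<in> {0..1} \<Longrightarrow> norm (\<gamma> t - \<gamma> s) \<le> M * norm (u p - u b) * \<bar>t - s\<bar>"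
    proof -
      have "u p \<in> U" "u b \<in> U" using insert.prems(2) pA by auto
      from paths[OF this] show thesis using that by blast
    qed
    define \<theta> where "\<theta> = (\<lambda>t. (t - p) / (b - p))"
    have \<theta>: "\<theta> t \<in> {0..1}" if "t \<in> {p..b}" for t using that pb by (auto simp: \<theta>_def divide_le_eq_1)
    have \<theta>_p: "\<theta> p = 0" and \<theta>_b: "\<theta> b = 1" using pb by (auto simp: \<theta>_def)
    have \<theta>_diff: "\<theta> t - \<theta> s = (t - s) / (b - p)" for s t by (simp add: \<theta>_def diff_divide_distrib)
    define w2 where "w2 = (\<lambda>t. \<gamma> (\<theta> t))"
    \<comment> \<open>The linear interpolation of \<open>M * W\<close> between consecutive nodes. It
      dominates the connecting path, which runs at speed at most
      \<open>M * norm (u p - u b) / (b - p)\<close>.\<close>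
    define h2 where "h2 = (\<lambda>t. M * (W p + \<theta> t * (W b - W p)))"
    have W_pb: "norm (u p - u b) \<le> W b - W p"
      using insert.prems(3)[of p b] pA pb by (simp add: norm_minus_commute)
    have 2: "dominated_on {p..b} w2 h2 (M * (W b - W p) / (b - p))"
      unfolding dominated_on_def
    proof (intro ballI impI conjI)
      fix s t assume st: "s \<in> {p..b}" "t \<in> {p..b}" "s \<le> t"
      have h2: "h2 t - h2 s = M * (W b - W p) * (\<theta> t - \<theta> s)" by (simp add: h2_def algebra_simps)
      have pos: "0 \<le> \<theta> t - \<theta> s" unfolding \<theta>_diff using st pb by simp
      have "norm (w2 t - w2 s) \<le> M * norm (u p - u b) * (\<theta> t - \<theta> s)"
        using \<gamma>(4)[OF \<theta>[OF st(1)] \<theta>[OF st(2)]] pos by (simp add: w2_def)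
      also have "\<dots> \<le> M * (W b - W p) * (\<theta> t - \<theta> s)"
        using W_pb M pos by (intro mult_right_mono mult_left_mono) auto
      finally show "norm (w2 t - w2 s) \<le> h2 t - h2 s" by (simp only: h2)
      show "h2 t - h2 s \<le> M * (W b - W p) / (b - p) * (t - s)" by (simp add: h2 \<theta>_diff)
    qed
    define w where "w = (\<lambda>t. if t \<le> p then w1 t else w2 t)"
    define h where "h = (\<lambda>t. if t \<le> p then h1 t else h2 t)"
    have "dominated_on {a..b} w h (max K1 (M * (W b - W p) / (b - p)))"
      unfolding w_def h_def
      by (rule dominated_on_glue[OF 1(2) 2]) (use pA 1(3,4) ap pb in \<open>auto simp: w2_def h2_def \<theta>_p \<gamma>(2)\<close>)
    moreover have "w ` {a..b} \<subseteq> U"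
      using 1(1) \<gamma>(1) \<theta> by (auto simp: w_def w2_def image_subset_iff)
    moreover have "w q = u q \<and> h q = M * W q" if "q \<in> insert b A" for q
      using that 1(3,4) A_p pb by (auto simp: w_def h_def w2_def h2_def \<theta>_b \<gamma>(3))
    ultimately show ?thesis unfolding MinMax by blast
  qed
qed

text \<open>Arc-length parametrization trades the variation bound of a Whitney path for the same
  number as Lipschitz constant, with no loss in \<open>M\<close>.\<close>

lemma whitney_lipschitz_paths:
  assumes "whitney_property U"
  obtains M where "M \<ge> 1" "\<And>u1 u2. u1 \<in> U \<Longrightarrow> u2 \<in> U \<Longrightarrow> \<exists>\<gamma>. \<gamma> ` {0..1} \<subseteq> U \<and> \<gamma> 0 = u1 \<and> \<gamma> 1 = u2 \<and>
      (\<forall>s\<in>{0..1}. \<forall>t\<in>{0..1}. norm (\<gamma> t - \<gamma> s) \<le> M * norm (u1 - u2) * \<bar>t - s\<bar>)"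
proof -
  obtain M where M: "M \<ge> 1" "\<And>u1 u2. u1 \<in> U \<Longrightarrow> u2 \<in> U \<Longrightarrow> \<exists>\<gamma>\<in>AC {0..1} U.
        \<gamma> 0 = u1 \<and> \<gamma> 1 = u2 \<and> total_variation {0..1} \<gamma> \<le> ennreal (M * norm (u1 - u2))"
    using assms unfolding whitney_property_def by blast
  show thesis
  proof (rule that[OF M(1)])
    fix u1 u2 assume "u1 \<in> U" "u2 \<in> U"
    then obtain \<gamma> where \<gamma>: "\<gamma> \<in> AC {0..1} U" "\<gamma> 0 = u1" "\<gamma> 1 = u2"
      "total_variation {0..1} \<gamma> \<le> ennreal (M * norm (u1 - u2))"
      using M(2) by blast
    have "0 \<le> M * norm (u1 - u2)" using M(1) by simp
    from absolutely_continuous_path_reparametrization[OF \<gamma>(1,4) this]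
    obtain \<gamma>2 where "\<gamma>2 ` {0..1} \<subseteq> U" "\<gamma>2 0 = \<gamma> 0" "\<gamma>2 1 = \<gamma> 1"
      "\<And>s t. s \<in> {0..1} \<Longrightarrow> t \<in> {0..1} \<Longrightarrow> norm (\<gamma>2 t - \<gamma>2 s) \<le> M * norm (u1 - u2) * \<bar>t - s\<bar>"
      by blast
    then show "\<exists>\<gamma>. \<gamma> ` {0..1} \<subseteq> U \<and> \<gamma> 0 = u1 \<and> \<gamma> 1 = u2 \<and>
      (\<forall>s\<in>{0..1}. \<forall>t\<in>{0..1}. norm (\<gamma> t - \<gamma> s) \<le> M * norm (u1 - u2) * \<bar>t - s\<bar>)"
      using \<gamma>(2,3) by (intro exI[of _ \<gamma>2]) auto
  qed
qed

lemma bracketing_grid_points: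
  assumes t: "a \<le> t" "t < b"
  obtains i where "i \<le> k" "a + (b - a) * real i / real (Suc k) \<le> t" "t \<le> a + (b - a) * real (Suc i) / real (Suc k)"
proof -
  define y where "y = (t - a) / (b - a) * real (Suc k)"
  have ab: "b - a > 0" using t by simp
  have "(t - a) / (b - a) < 1" using t by simp
  then have "y < 1 * real (Suc k)" unfolding y_def by (intro mult_strict_right_mono) auto
  then have y: "0 \<le> y" "y < real (Suc k)" using t ab by (auto simp: y_def)
  define i where "i = nat \<lfloor>y\<rfloor>"
  have i: "real i \<le> y" "y \<le> real (Suc i)" using y by (auto simp: i_def) linarith+
  have t_eq: "t = a + (b - a) * y / real (Suc k)" using ab by (simp add: y_def)
  show thesis
  proof (rule that[of i])
    show "i \<le> k" using i(1) y(2) by linarith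
    show "a + (b - a) * real i / real (Suc k) \<le> t" "t \<le> a + (b - a) * real (Suc i) / real (Suc k)"
      unfolding t_eq using i ab by (intro add_left_mono divide_right_mono mult_left_mono; simp)+
  qed
qed

text \<open>The \<open>k\<close>-th approximant interpolates the input on a grid of mesh \<open>(b - a) / (k + 1)\<close> enlarged by
  the first discontinuities of its variation function: at these points the approximants are
  eventually exact, elsewhere continuity of the variation function yields convergence.\<close>

lemma BV_approximation:
  fixes u :: "real \<Rightarrow> 'a::euclidean_space"
  assumes ab: "a \<le> b" and U: "whitney_property U" and u: "u \<in> BV {a..b} U"
  obtains w h K C where "\<And>k. w k ` {a..b} \<subseteq> U" "\<And>k::nat. dominated_on {a..b} (w k) (h k) (K k)"
    "\<And>k. h k b - h k a \<le> C" "\<And>t. t \<in> {a..b} \<Longrightarrow> (\<lambda>k. w k t) \<longlonglongrightarrow> u t"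
proof -
  have uU: "u t \<in> U" if "t \<in> {a..b}" for t using u that by (auto simp: BV_def)
  define W where "W = (\<lambda>t. enn2real (total_variation {a..t} u))"
  have W: "norm (u t - u s) \<le> W t - W s" if "a \<le> s" "s \<le> t" "t \<le> b" for s t
    unfolding W_def by (rule variation_function_dominates[OF _ that]) (use u in \<open>simp add: BV_def\<close>)
  have W_mono: "W s \<le> W t" if "a \<le> s" "s \<le> t" "t \<le> b" for s t
    using order_trans[OF norm_ge_zero W[OF that]] by simp
  obtain M where M: "M \<ge> 1" "\<And>u1 u2. u1 \<in> U \<Longrightarrow> u2 \<in> U \<Longrightarrow> \<exists>\<gamma>. \<gamma> ` {0..1} \<subseteq> U \<and> \<gamma> 0 = u1 \<and> \<gamma> 1 = u2 \<and>
      (\<forall>s\<in>{0..1}. \<forall>t\<in>{0..1}. norm (\<gamma> t - \<gamma> s) \<le> M * norm (u1 - u2) * \<bar>t - s\<bar>)"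
    using whitney_lipschitz_paths[OF U] by metis
  \<comment> \<open>At most countably many points, since \<open>W\<close> is monotone; they can
    therefore all be scheduled to become nodes.\<close>
  define D where "D = {t \<in> {a..b}. \<not> continuous (at t within {a..b}) W}"
  have D: "countable D" unfolding D_def
    by (rule mono_on_ctble_discont) (auto intro!: mono_onI W_mono)
  define grid where "grid = (\<lambda>k i. a + (b - a) * real i / real (Suc k))"
  \<comment> \<open>Intersecting with \<open>{a..b}\<close> protects against an empty
    \<open>D\<close>, for which \<open>from_nat_into\<close> returns an unspecified number.\<close>
  define P where "P = (\<lambda>k. {a, b} \<union> grid k ` {..Suc k} \<union> (from_nat_into D ` {..k} \<inter> {a..b}))"
  have grid_in: "grid k i \<in> {a..b}" if "i \<le> Suc k" for k i
  proof -
    have "0 \<le> (b - a) * (real i / real (Suc k))" using ab by simp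
    moreover have "(b - a) * (real i / real (Suc k)) \<le> (b - a) * 1"
      using ab that by (intro mult_left_mono) auto
    ultimately show ?thesis by (simp add: grid_def)
  qed
  have P_fin: "finite (P k)" and P_sub: "P k \<subseteq> {a..b}" and P_ab: "a \<in> P k" "b \<in> P k" for k
    using grid_in ab by (auto simp: P_def)
  have P_Min: "Min (P k) = a" and P_Max: "Max (P k) = b" for k
    using P_fin[of k] P_sub[of k] P_ab[of k] by (auto intro!: Min_eqI Max_eqI)
  have "\<exists>w h K. w ` {a..b} \<subseteq> U \<and> dominated_on {a..b} w h K \<and> (\<forall>p\<in>P k. w p = u p \<and> h p = M * W p)" for k
    unfolding P_Min[of k, symmetric] P_Max[of k, symmetric]
  proof (rule finite_set_interpolation[OF M(2) _ P_fin])
    show "u ` P k \<subseteq> U" using uU P_sub by blast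
    show "norm (u t - u s) \<le> W t - W s" if "s \<in> P k" "t \<in> P k" "s \<le> t" for s t
      using that P_sub[of k] by (intro W) auto
  qed (use M(1) P_ab in auto)
  then obtain w h K where whK: "\<And>k. w k ` {a..b} \<subseteq> U" "\<And>k. dominated_on {a..b} (w k) (h k) (K k)"
    "\<And>k p. p \<in> P k \<Longrightarrow> w k p = u p" "\<And>k p. p \<in> P k \<Longrightarrow> h k p = M * W p"
    by metis
  show thesis
  proof (rule that[of w h K "M * (W b - W a)"])
    show "h k b - h k a \<le> M * (W b - W a)" for k
      using whK(4)[OF P_ab(1)] whK(4)[OF P_ab(2)] by (simp add: right_diff_distrib)
    fix t assume t: "t \<in> {a..b}"
    consider "t = b" | "t \<in> D" | "t < b" "t \<notin> D" using t by fastforce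
    then show "(\<lambda>k. w k t) \<longlonglongrightarrow> u t"
    proof cases
      case 1
      then show ?thesis using whK(3)[OF P_ab(2)] by simp
    next
      case 2
      obtain n where n: "t = from_nat_into D n" using from_nat_into_surj[OF D 2] by metis
      have "w k t = u t" if "k \<ge> n" for k
        using n t that by (intro whK(3)) (auto simp: P_def)
      then have "\<forall>\<^sub>F k in sequentially. w k t = u t" by (auto simp: eventually_sequentially)
      then show ?thesis by (rule tendsto_eventually)
    next
      case 3
      have cont: "continuous (at t within {a..b}) W" using 3(2) t by (simp add: D_def)
      show ?thesis
      proof (rule metric_LIMSEQ_I)
        fix e :: real assume e: "e > 0"
        \<comment> \<open>\<open>W\<close> oscillates by less than \<open>2 * e'\<close> across the
          cell around \<open>t\<close>; the approximant contributes this with factor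
          \<open>M\<close>, the input \<open>u\<close> with factor 1.\<close>
        define e' where "e' = e / (2 * (M + 1))"
        have e': "e' > 0" using e M(1) by (simp add: e'_def)
        obtain \<delta> where \<delta>: "\<delta> > 0" "\<And>s. s \<in> {a..b} \<Longrightarrow> dist s t < \<delta> \<Longrightarrow> dist (W s) (W t) < e'"
          using cont e' unfolding continuous_within_eps_delta by blast
        obtain N where N: "(b - a) / \<delta> < real N" using reals_Archimedean2 by blast
        have "dist (w k t) (u t) < e" if k: "k \<ge> N" for k
        proof -
          obtain i where i: "i \<le> k" "grid k i \<le> t" "t \<le> grid k (Suc i)"
            using bracketing_grid_points[of a t b k] t 3(1) unfolding grid_def by (metis atLeastAtMost_iff)
          define p where "p = grid k i"
          define q where "q = grid k (Suc i)"
          have pq: "p \<in> P k" "q \<in> P k" using i(1) by (auto simp: p_def q_def P_def)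
          then have pq_in: "p \<in> {a..b}" "q \<in> {a..b}" using P_sub[of k] by auto
          have ptq: "p \<le> t" "t \<le> q" using i by (auto simp: p_def q_def)
          have "(b - a) < real (Suc k) * \<delta>"
          proof -
            have "b - a < real N * \<delta>" using N \<delta>(1) by (simp add: divide_less_eq)
            also have "\<dots> \<le> real (Suc k) * \<delta>" using k \<delta>(1) by (intro mult_right_mono) auto
            finally show ?thesis .
          qed
          then have mesh: "(b - a) / real (Suc k) < \<delta>" by (simp add: divide_less_eq mult.commute)
          have "q - p = (b - a) / real (Suc k)"
          proof -
            have "q - p = ((b - a) * real (Suc i) - (b - a) * real i) / real (Suc k)"
              by (simp only: p_def q_def grid_def diff_divide_distrib add_diff_cancel_left)
            also have "(b - a) * real (Suc i) - (b - a) * real i = b - a" by (simp add: algebra_simps)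
            finally show ?thesis .
          qed
          with mesh have "dist p t < \<delta>" "dist q t < \<delta>" using ptq by (auto simp: dist_real_def)
          then have "\<bar>W p - W t\<bar> < e'" "\<bar>W q - W t\<bar> < e'" using \<delta>(2) pq_in by (auto simp: dist_real_def)
          then have Wqp: "W q - W p < 2 * e'" by linarith
          \<comment> \<open>Inside a cell \<open>h k\<close> is not known explicitly, but it is
            monotone, so the increment from \<open>p\<close> to \<open>t\<close> is at most that
            between the nodes, where \<open>h k\<close> equals \<open>M * W\<close>.\<close>
          have hm: "h k t \<le> h k q"
            using order_trans[OF norm_ge_zero dominated_onD(1)[OF whK(2) t pq_in(2) ptq(2)]] by simp
          have "norm (w k t - w k p) \<le> h k q - h k p"
            using dominated_onD(1)[OF whK(2)[of k] pq_in(1) t ptq(1)] hm by simp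
          also have "\<dots> = M * (W q - W p)" using whK(4)[OF pq(1)] whK(4)[OF pq(2)] by (simp add: right_diff_distrib)
          finally have 1: "norm (w k t - u p) \<le> M * (W q - W p)" using whK(3)[OF pq(1)] by simp
          have 2: "norm (u t - u p) \<le> W q - W p"
            using W[of p t] W_mono[of t q] pq_in t ptq by auto
          have "dist (w k t) (u t) \<le> norm (w k t - u p) + norm (u t - u p)"
            using dist_triangle2[of "w k t" "u t" "u p"] by (simp add: dist_norm)
          also have "\<dots> \<le> (M + 1) * (W q - W p)" using 1 2 by (simp add: algebra_simps)
          also have "\<dots> < (M + 1) * (2 * e')" using Wqp M(1) by (intro mult_strict_left_mono) auto
          also have "\<dots> = e" using M(1) by (simp add: e'_def field_simps)
          finally show ?thesis .
        qed
        then show "\<exists>N. \<forall>k\<ge>N. dist (w k t) (u t) < e" by blast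
      qed
    qed
  qed (fact whK(1) whK(2))+
qed

section \<open>Selection of a convergent subsequence\<close>

text \<open>A subsequence of the dominating functions converges at the rationals; wherever the limit is
  continuous it controls the oscillation of the tail of the sequence \<open>x\<close>.  The countably many
  remaining points are added to the diagonal selection.\<close>

lemma helly_dominated_selection:
  fixes x :: "nat \<Rightarrow> real \<Rightarrow> 'a::euclidean_space" and H :: "nat \<Rightarrow> real \<Rightarrow> real"
  assumes ab: "a \<le> b"
    and dom: "\<And>k s t. a \<le> s \<Longrightarrow> s \<le> t \<Longrightarrow> t \<le> b \<Longrightarrow> norm (x k t - x k s) \<le> H k t - H k s"
    and S: "\<And>k. H k b - H k a \<le> S" and R: "\<And>k t. t \<in> {a..b} \<Longrightarrow> norm (x k t) \<le> R"
  obtains r where "strict_mono (r :: nat \<Rightarrow> nat)" "\<And>t. t \<in> {a..b} \<Longrightarrow> convergent (\<lambda>k. x (r k) t)"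
proof -
  have H_mono: "H k s \<le> H k t" if "a \<le> s" "s \<le> t" "t \<le> b" for k s t
    using order_trans[OF norm_ge_zero dom[OF that, of k]] by simp
  define Q where "Q = {a, b} \<union> (\<rat> \<inter> {a..b})"
  have Q: "countable Q" "Q \<subseteq> {a..b}" "a \<in> Q" "b \<in> Q"
    using ab by (auto simp: Q_def intro: countable_Int1 countable_rat)
  \<comment> \<open>Only increments of \<open>H k\<close> are bounded, not its values, so the
    functions are normalized to vanish at \<open>a\<close> before the first selection.\<close>
  have HS: "norm (H k t - H k a) \<le> S" if "t \<in> Q" for k t
    using H_mono[of a t k] H_mono[of t b k] S[of k] Q(2) that by auto
  obtain r1 where r1: "strict_mono (r1 :: nat \<Rightarrow> nat)"
    "\<And>q. q \<in> Q \<Longrightarrow> \<exists>l. (\<lambda>n. H (r1 n) q - H (r1 n) a) \<longlonglongrightarrow> l"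
    using function_convergent_subsequence[OF Q(1), of "\<lambda>k t. H k t - H k a" S] HS by auto
  then obtain \<eta> where \<eta>: "\<And>q. q \<in> Q \<Longrightarrow> (\<lambda>n. H (r1 n) q - H (r1 n) a) \<longlonglongrightarrow> \<eta> q"
    by metis
  have \<eta>_mono: "\<eta> p \<le> \<eta> q" if "p \<in> Q" "q \<in> Q" "p \<le> q" for p q
    by (rule LIMSEQ_le[OF \<eta>[OF that(1)] \<eta>[OF that(2)]]) (use that Q(2) in \<open>auto intro!: exI[of _ 0] H_mono\<close>)
  \<comment> \<open>A monotone extension of the limit \<open>\<eta>\<close> from \<open>Q\<close> to
    all times. It agrees with \<open>\<eta>\<close> on \<open>Q\<close>, and monotonicity leaves
    only countably many discontinuities to be added to the second selection.\<close>
  define G where "G = (\<lambda>t. Sup (\<eta> ` {q \<in> Q. q \<le> t}))"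
  have bdd: "bdd_above (\<eta> ` {q \<in> Q. q \<le> t})" for t
    using \<eta>_mono[OF _ Q(4)] Q(2) by (intro bdd_aboveI2[of _ _ "\<eta> b"]) auto
  have G_mono: "G s \<le> G t" if "a \<le> s" "s \<le> t" for s t
    unfolding G_def using Q(3) that by (intro cSup_subset_mono bdd) auto
  have G_Q: "G q = \<eta> q" if "q \<in> Q" for q
    unfolding G_def using that \<eta>_mono by (intro cSup_eq_maximum) auto
  define D where "D = {t \<in> {a..b}. \<not> continuous (at t within {a..b}) G}"
  have D: "countable D" unfolding D_def
    by (rule mono_on_ctble_discont) (auto intro!: mono_onI G_mono)
  obtain r2 where r2: "strict_mono (r2 :: nat \<Rightarrow> nat)"
    "\<And>t. t \<in> Q \<union> D \<Longrightarrow> \<exists>l. (\<lambda>n. x (r1 (r2 n)) t) \<longlonglongrightarrow> l"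
  proof (rule function_convergent_subsequence[of "Q \<union> D" "\<lambda>n. x (r1 n)" R])
    show "norm (x (r1 n) t) \<le> R" if "t \<in> Q \<union> D" for n t
      using that Q(2) by (intro R) (auto simp: D_def)
  qed (use Q(1) D in auto)
  define r where "r = r1 \<circ> r2"
  show thesis
  proof (rule that[of r])
    show "strict_mono r" unfolding r_def using r1(1) r2(1) by (rule strict_mono_o)
    fix t assume t: "t \<in> {a..b}"
    show "convergent (\<lambda>k. x (r k) t)"
    proof (cases "t \<in> Q \<union> D")
      case True
      then show ?thesis using r2(2) by (auto simp: convergent_def r_def)
    next
      case False
      then have t_ab: "a < t" "t < b" using t Q(3,4) by (auto simp: less_le)
      have cont: "continuous (at t within {a..b}) G" using False t by (simp add: D_def)
      have "Cauchy (\<lambda>k. x (r k) t)"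
      proof (rule metric_CauchyI)
        fix e :: real assume e: "e > 0"
        \<comment> \<open>An oscillation below \<open>e / 8\<close> on either side of
          \<open>t\<close> gives \<open>\<eta> q - \<eta> p < e / 4\<close> for rationals
          \<open>p < t < q\<close>, hence the same bound for late increments of
          \<open>H\<close>.\<close>
        obtain \<delta> where \<delta>: "\<delta> > 0" "\<And>s. s \<in> {a..b} \<Longrightarrow> dist s t < \<delta> \<Longrightarrow> dist (G s) (G t) < e / 8"
          using cont e unfolding continuous_within_eps_delta by (metis divide_pos_pos zero_less_numeral)
        obtain p where p: "p \<in> \<rat>" "max a (t - \<delta>) < p" "p < t"
          using Rats_dense_in_real[of "max a (t - \<delta>)" t] t_ab \<delta>(1) by auto
        obtain q where q: "q \<in> \<rat>" "t < q" "q < min b (t + \<delta>)"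
          using Rats_dense_in_real[of t "min b (t + \<delta>)"] t_ab \<delta>(1) by auto
        have pq: "p \<in> Q" "q \<in> Q" using p q t_ab by (auto simp: Q_def)
        have "\<bar>G p - G t\<bar> < e / 8" "\<bar>G q - G t\<bar> < e / 8"
          using \<delta>(2)[of p] \<delta>(2)[of q] p q t_ab by (auto simp: dist_real_def)
        then have "\<eta> q - \<eta> p < e / 4" using G_Q[OF pq(1)] G_Q[OF pq(2)] by linarith
        moreover have "(\<lambda>n. (H (r1 (r2 n)) q - H (r1 (r2 n)) a) - (H (r1 (r2 n)) p - H (r1 (r2 n)) a)) \<longlonglongrightarrow> \<eta> q - \<eta> p"
          using LIMSEQ_subseq_LIMSEQ[OF \<eta>[OF pq(2)] r2(1)] LIMSEQ_subseq_LIMSEQ[OF \<eta>[OF pq(1)] r2(1)]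
          by (intro tendsto_diff) (simp_all add: o_def)
        ultimately have "\<forall>\<^sub>F n in sequentially. (H (r1 (r2 n)) q - H (r1 (r2 n)) a) - (H (r1 (r2 n)) p - H (r1 (r2 n)) a) < e / 4"
          by (intro order_tendstoD(2))
        then obtain N1 where N1: "\<And>n. n \<ge> N1 \<Longrightarrow> H (r n) q - H (r n) p < e / 4"
          unfolding eventually_sequentially r_def by auto
        have "Cauchy (\<lambda>n. x (r n) p)"
          using r2(2)[of p] pq(1) by (auto simp: r_def intro: convergent_Cauchy convergentI)
        then obtain N2 where N2: "\<And>m n. m \<ge> N2 \<Longrightarrow> n \<ge> N2 \<Longrightarrow> dist (x (r m) p) (x (r n) p) < e / 4"
          using e unfolding Cauchy_def by (metis divide_pos_pos zero_less_numeral)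
        \<comment> \<open>The time \<open>t\<close> itself lies outside \<open>Q\<close>, so the
          increment of \<open>H\<close> up to \<open>t\<close> is enlarged to the one up to the
          rational \<open>q\<close>, where convergence is known.\<close>
        have near: "dist (x (r n) t) (x (r n) p) < e / 4" if "n \<ge> N1" for n
        proof -
          have "norm (x (r n) t - x (r n) p) \<le> H (r n) t - H (r n) p" using p t_ab by (intro dom) auto
          also have "\<dots> \<le> H (r n) q - H (r n) p" using H_mono[of t q "r n"] q t_ab by auto
          finally show ?thesis using N1[OF that] by (simp add: dist_norm)
        qed
        have "dist (x (r m) t) (x (r n) t) < e" if "m \<ge> max N1 N2" "n \<ge> max N1 N2" for m n
        proof -
          have "dist (x (r m) t) (x (r n) t) \<le> dist (x (r m) t) (x (r m) p) + dist (x (r m) p) (x (r n) p) + dist (x (r n) t) (x (r n) p)"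
            using dist_triangle[of "x (r m) t" "x (r n) t" "x (r m) p"] dist_triangle[of "x (r m) p" "x (r n) t" "x (r n) p"]
            by (simp add: dist_commute)
          also have "\<dots> < e / 4 + e / 4 + e / 4" using near[of m] near[of n] N2[of m n] that by (intro add_strict_mono) auto
          also have "\<dots> < e" using e by simp
          finally show ?thesis .
        qed
        then show "\<exists>N. \<forall>m\<ge>N. \<forall>n\<ge>N. dist (x (r m) t) (x (r n) t) < e" by blast
      qed
      then show ?thesis by (rule Cauchy_convergent)
    qed
  qed
qed

section \<open>From pointwise convergence to the limit solution\<close>

lemma L1_norm_tendsto_zero:
  fixes z :: "nat \<Rightarrow> real \<Rightarrow> 'a::euclidean_space"
  assumes meas: "\<And>k. z k \<in> borel_measurable (lebesgue_on {a..b})"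
    and bd: "\<And>k t. t \<in> {a..b} \<Longrightarrow> norm (z k t) \<le> B"
    and lim: "\<And>t. t \<in> {a..b} \<Longrightarrow> (\<lambda>k. z k t) \<longlonglongrightarrow> y t"
  shows "y absolutely_integrable_on {a..b}" "(\<lambda>k. L1_norm {a..b} (\<lambda>t. z k t - y t)) \<longlonglongrightarrow> 0"
proof -
  have y_meas: "y \<in> borel_measurable (lebesgue_on {a..b})"
    by (rule borel_measurable_LIMSEQ_metric[OF meas]) (use lim in simp)
  have y_bd: "norm (y t) \<le> B" if "t \<in> {a..b}" for t
    by (rule LIMSEQ_le_const2[OF tendsto_norm[OF lim[OF that]]]) (use bd[OF that] in auto)
  show "y absolutely_integrable_on {a..b}"
    by (rule integrable_on_bounded_measurable[OF y_meas order_refl y_bd])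
  have "(\<lambda>k. integral\<^sup>L (lebesgue_on {a..b}) (\<lambda>t. norm (z k t - y t))) \<longlonglongrightarrow> integral\<^sup>L (lebesgue_on {a..b}) (\<lambda>_. 0::real)"
  proof (rule integral_dominated_convergence[where w = "\<lambda>_. 2 * B"])
    show "(\<lambda>t. norm (z k t - y t)) \<in> borel_measurable (lebesgue_on {a..b})" for k
      using meas y_meas by measurable
    show "AE t in lebesgue_on {a..b}. (\<lambda>k. norm (z k t - y t)) \<longlonglongrightarrow> 0"
      using lim by (intro AE_I2) (auto intro!: tendsto_norm_zero LIM_zero)
    show "AE t in lebesgue_on {a..b}. norm (norm (z k t - y t)) \<le> 2 * B" for k
    proof (rule AE_I2)
      fix t assume "t \<in> space (lebesgue_on {a..b})"
      then have "t \<in> {a..b}" by simp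
      then show "norm (norm (z k t - y t)) \<le> 2 * B"
        using norm_triangle_ineq4[of "z k t" "y t"] bd[of t k] y_bd[of t] by simp
    qed
  qed (auto simp: integrable_restrict_space)
  moreover have "L1_norm {a..b} (\<lambda>t. z k t - y t) = integral\<^sup>L (lebesgue_on {a..b}) (\<lambda>t. norm (z k t - y t))" for k
    unfolding L1_norm_def set_lebesgue_integral_def
    by (subst integral_restrict_space) auto
  ultimately show "(\<lambda>k. L1_norm {a..b} (\<lambda>t. z k t - y t)) \<longlonglongrightarrow> 0" by simp
qed

theorem theorem2p4:
  fixes a b :: real
    and U :: "(real^'m) set" and V :: "(real^'l) set"
    and f :: "real \<Rightarrow> real^'n \<Rightarrow> real^'m \<Rightarrow> real^'l \<Rightarrow> real^'n"
    and g :: "'m \<Rightarrow> real^'n \<Rightarrow> real^'n"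
    and xbar :: "real^'n"
    and u :: "real \<Rightarrow> real^'m" and v :: "real \<Rightarrow> real^'l"
  assumes ab: "a \<le> b"
    and U_compact: "compact U"
    and U_approx: "AC_approximable U"
    and V_compact: "compact V"
    and f_measurable:
      "\<And>x u v. v \<in> V \<Longrightarrow> (\<lambda>t. f t x u v) \<in> borel_measurable (lebesgue_on {a..b})"
    and f_continuous:
      "\<And>t. t \<in> {a..b} \<Longrightarrow> continuous_on (UNIV \<times> UNIV \<times> V) (\<lambda>(x, u, v). f t x u v)"
    and f_lipschitz:
      "\<And>x0 u0. \<exists>r>0. \<exists>L. \<forall>t\<in>{a..b}. \<forall>v\<in>V. L-lipschitz_on (ball (x0, u0) r) (\<lambda>(x, u). f t x u v)"
    and g_C1: "\<And>\<alpha>. C1_map (g \<alpha>)"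
    and growth:
      "\<exists>M>0. \<forall>t\<in>{a..b}. \<forall>v\<in>V. \<forall>x u. norm (f t x u v, \<chi> \<alpha>. g \<alpha> x) \<le> M * (1 + norm (x, u))"
    and U_whitney: "whitney_property U"
    and u_BV: "u \<in> BV {a..b} U"
    and v_L1: "v \<in> L1_reps {a..b} V"
  shows "\<exists>x. BV_simple_limit_solution a b U f g xbar u v x"
proof -
  interpret impulsive_system a b U V f g v
    by unfold_locales fact+
  obtain w h K C where w: "\<And>k. w k ` {a..b} \<subseteq> U" "\<And>k::nat. dominated_on {a..b} (w k) (h k) (K k)"
    "\<And>k. h k b - h k a \<le> C" "\<And>t. t \<in> {a..b} \<Longrightarrow> (\<lambda>k. w k t) \<longlonglongrightarrow> u t"
    using BV_approximation[OF ab U_whitney u_BV] by metis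
  have w_dom: "norm (w k t - w k s) \<le> h k t - h k s" "norm (w k t - w k s) \<le> K k * (t - s)"
    if st: "s \<in> {a..b}" "t \<in> {a..b}" "s \<le> t" for k s t
    using dominated_onD[OF w(2)[of k] st] by auto
  obtain R S where RS: "\<And>u h K. u ` {a..b} \<subseteq> U \<Longrightarrow> dominated_on {a..b} u h K \<Longrightarrow> h b - h a \<le> C \<Longrightarrow>
    \<exists>x H. caratheodory_solution a b f g xbar u v x \<and> (\<forall>t\<in>{a..b}. norm (x t) \<le> R) \<and>
      H b - H a \<le> S \<and> (\<forall>s t. a \<le> s \<longrightarrow> s \<le> t \<longrightarrow> t \<le> b \<longrightarrow> norm (x t - x s) \<le> H t - H s)"
    using solutions_uniformly_bounded[of C xbar] by metis
  \<comment> \<open>The approximants share the variation bound \<open>C\<close>, so one radius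
    \<open>R\<close> and one budget \<open>S\<close> serve all indices, although the constants
    \<open>K k\<close> vary.\<close>
  from RS[OF w(1-3)] obtain X H where X: "\<And>k. caratheodory_solution a b f g xbar (w k) v (X k)"
    "\<And>k t. t \<in> {a..b} \<Longrightarrow> norm (X k t) \<le> R" "\<And>k. H k b - H k a \<le> S"
    "\<And>k s t. a \<le> s \<Longrightarrow> s \<le> t \<Longrightarrow> t \<le> b \<Longrightarrow> norm (X k t - X k s) \<le> H k t - H k s"
    by metis
  obtain r where r: "strict_mono (r :: nat \<Rightarrow> nat)" "\<And>t. t \<in> {a..b} \<Longrightarrow> convergent (\<lambda>k. X (r k) t)"
    using helly_dominated_selection[of a b X H S R] ab X(2-4) by metis
  define x where "x = (\<lambda>t. lim (\<lambda>k. X (r k) t))"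
  have x: "(\<lambda>k. X (r k) t) \<longlonglongrightarrow> x t" if "t \<in> {a..b}" for t
    unfolding x_def using r(2)[OF that] by (simp add: convergent_LIMSEQ_iff)
  have wr: "(\<lambda>k. w (r k) t) \<longlonglongrightarrow> u t" if "t \<in> {a..b}" for t
    using LIMSEQ_subseq_LIMSEQ[OF w(4)[OF that] r(1)] by (simp add: o_def)
  obtain \<rho> where \<rho>: "\<And>u. u \<in> U \<Longrightarrow> norm u \<le> \<rho>"
    using compact_imp_bounded[OF U_compact] unfolding bounded_iff by blast
  \<comment> \<open>State and input are paired so that one dominated convergence argument covers the
    joint norm in \<open>approximating_inputs\<close>; the integrability of each component is
    recovered afterwards by projection.\<close>
  define z where "z = (\<lambda>k t. (X (r k) t, w (r k) t))"
  have w_AC: "w k \<in> AC {a..b} U" for k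
    unfolding AC_def using w(1) w_dom(2) by (auto intro!: absolutely_continuous_on_lipschitz)
  then have w_cont: "continuous_on {a..b} (w k)" for k
    unfolding AC_def by (blast intro: absolutely_continuous_on_imp_continuous_on)
  have X_cont: "continuous_on {a..b} (X k)" for k
    using X(1)[of k] unfolding caratheodory_solution_def by (blast intro: absolutely_continuous_on_imp_continuous_on)
  have z_meas: "z k \<in> borel_measurable (lebesgue_on {a..b})" for k
    unfolding z_def by (intro continuous_imp_measurable_on_sets_lebesgue continuous_on_Pair w_cont X_cont) auto
  have z_bd: "norm (z k t) \<le> R + \<rho>" if "t \<in> {a..b}" for k t
  proof -
    have "w (r k) t \<in> U" using w(1)[of "r k"] that by auto
    from order_trans[OF norm_Pair_le_add add_mono[OF X(2)[OF that] \<rho>[OF this]]]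
    show ?thesis by (simp add: z_def)
  qed
  have z_lim: "(\<lambda>k. z k t) \<longlonglongrightarrow> (x t, u t)" if "t \<in> {a..b}" for t
    unfolding z_def using x[OF that] wr[OF that] by (rule tendsto_Pair)
  have xu_int: "(\<lambda>t. (x t, u t)) absolutely_integrable_on {a..b}"
    and L1: "(\<lambda>k. L1_norm {a..b} (\<lambda>t. z k t - (x t, u t))) \<longlonglongrightarrow> 0"
    using L1_norm_tendsto_zero[OF z_meas z_bd z_lim] by auto
  \<comment> \<open>The selected sequence converges at every point of the interval, so the same
    inputs work for each \<tau>; this makes the limit solution simple.\<close>
  have approx: "approximating_inputs a b U f g xbar u v x \<tau> (\<lambda>k. w (r k))" if \<tau>: "\<tau> \<in> {a..b}" for \<tau>
    unfolding approximating_inputs_def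
  proof (intro conjI allI exI[of _ "\<lambda>k. X (r k)"] exI[of _ R] ballI)
    show "w (r k) \<in> AC {a..b} U" for k by (rule w_AC)
    have "(\<lambda>k. norm (z k \<tau> - (x \<tau>, u \<tau>))) \<longlonglongrightarrow> 0"
      by (intro tendsto_norm_zero LIM_zero z_lim \<tau>)
    from tendsto_add[OF this L1]
    show "(\<lambda>k. norm ((X (r k) \<tau>, w (r k) \<tau>) - (x \<tau>, u \<tau>)) +
        L1_norm {a..b} (\<lambda>t. (X (r k) t, w (r k) t) - (x t, u t))) \<longlonglongrightarrow> 0"
      by (simp add: z_def)
  qed (use X in auto)
  have "x absolutely_integrable_on {a..b}" "u absolutely_integrable_on {a..b}"
    using absolutely_integrable_linear[OF xu_int bounded_linear_fst] absolutely_integrable_linear[OF xu_int bounded_linear_snd]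
    by (simp_all add: o_def)
  then have "simple_limit_solution a b U f g xbar u v x"
    unfolding simple_limit_solution_def limit_solution_def L1_maps_def
    using u_BV approx unfolding BV_def by blast
  moreover have "total_variation {a..b} (w (r k)) \<le> ennreal C" for k
    using total_variation_dominated[OF ab, of "w (r k)" "h (r k)"] w_dom(1) w(3)[of "r k"]
    by (auto intro: order_trans ennreal_leI)
  ultimately show ?thesis
    unfolding BV_simple_limit_solution_def using approx by blast
qed

end
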